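(* Let $X\subset\mathbb{P}^4$ be a quintic threefold whose equation, up to a coordinate transformation, is of the form $a\,x_0^2x_2x_4^2+b\,x_0x_1x_2x_3x_4+c\,x_1^2x_2x_3^2$ with $a,b,c\in\mathbb{C}$ not all zero. (1) If $X$ belongs to one of the families US1-I, US2-I, then $X$ is unstable. (2) If $X$ is of type SS1-I, then its orbit is not closed and it degenerates to MO2-V. (3) If $X$ is of type SS2-I, then its orbit is not closed and it degenerates to MO2-V. Otherwise, $X$ has a closed orbit.
   Context: $SL(5,\mathbb{C})$ acts on the space $V$ of quintic forms in $x_0,\dots,x_4$ by change of coordinates. "Orbit" means the $SL(5,\mathbb{C})$-orbit in $V$ of the equation of $X$. Unstable means not semistable, i.e. all non-constant homogeneous invariant polynomials on $V$ vanish at the equation. "Degenerates to MO2-V" means that the orbit closure contains a form equal, up to a change of coordinates, to a nonzero multiple of $x_0x_1x_2x_3x_4$. "Of type / belongs to" a family means that the equation has the given shape after a change of coordinates. In the following families every displayed monomial carries a nonzero coefficient (suppressed in the notation): SS1-I: $x_0^2x_2x_4^2+x_0x_1x_2x_3x_4$. SS2-I: $x_0x_1x_2x_3x_4+x_1^2x_2x_3^2$. US1-I: $x_0^2x_2x_4^2$. US2-I: $x_1^2x_2x_3^2$. *)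

theory Defs
  imports "HOL-Analysis.Analysis"
begin

definition exponents :: "nat \<Rightarrow> ('n::finite \<Rightarrow> nat) set" where
  "exponents d = {\<alpha>. (\<Sum>i\<in>UNIV. \<alpha> i) = d}"

definition monomial :: "('n::finite \<Rightarrow> nat) \<Rightarrow> complex ^ 'n \<Rightarrow> complex" where
  "monomial \<alpha> x = (\<Prod>i\<in>UNIV. (x $ i) ^ \<alpha> i)"

definition homogeneous_poly :: "nat \<Rightarrow> (complex ^ 'n::finite \<Rightarrow> complex) \<Rightarrow> bool" where
  "homogeneous_poly d P \<longleftrightarrow> (\<exists>c. \<forall>x. P x = (\<Sum>\<alpha>\<in>exponents d. c \<alpha> * monomial \<alpha> x))"

lemma finite_exponents [simp]: "finite (exponents d :: ('n::finite \<Rightarrow> nat) set)"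
proof (rule finite_subset)
  show "exponents d \<subseteq> (PiE UNIV (\<lambda>_. {..d}) :: ('n \<Rightarrow> nat) set)"
    by (auto simp: exponents_def intro: member_le_sum)
  show "finite (PiE UNIV (\<lambda>_. {..d}) :: ('n \<Rightarrow> nat) set)"
    by (intro finite_PiE) auto
qed

lemma homogeneous_poly_cmult:
  assumes "homogeneous_poly d P"
  shows "homogeneous_poly d (\<lambda>x. k * P x)"
proof -
  obtain c where c: "\<And>x. P x = (\<Sum>\<alpha>\<in>exponents d. c \<alpha> * monomial \<alpha> x)"
    using assms unfolding homogeneous_poly_def by blast
  show ?thesis unfolding homogeneous_poly_def
    by (rule exI[of _ "\<lambda>\<alpha>. k * c \<alpha>"]) (simp add: c sum_distrib_left mult.assoc)
qed

lemma homogeneous_poly_add: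
  assumes "homogeneous_poly d P" "homogeneous_poly d Q"
  shows "homogeneous_poly d (\<lambda>x. P x + Q x)"
proof -
  obtain c where c: "\<And>x. P x = (\<Sum>\<alpha>\<in>exponents d. c \<alpha> * monomial \<alpha> x)"
    using assms(1) unfolding homogeneous_poly_def by blast
  obtain e where e: "\<And>x. Q x = (\<Sum>\<alpha>\<in>exponents d. e \<alpha> * monomial \<alpha> x)"
    using assms(2) unfolding homogeneous_poly_def by blast
  show ?thesis unfolding homogeneous_poly_def
    by (rule exI[of _ "\<lambda>\<alpha>. c \<alpha> + e \<alpha>"]) (simp add: c e sum.distrib distrib_right)
qed

lemma homogeneous_poly_sum:
  assumes "\<And>i. i \<in> I \<Longrightarrow> homogeneous_poly d (P i)"
  shows "homogeneous_poly d (\<lambda>x. \<Sum>i\<in>I. P i x)"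
  using assms
proof (induction I rule: infinite_finite_induct)
  case (insert i I)
  then show ?case using homogeneous_poly_add[of d "P i" "\<lambda>x. \<Sum>i\<in>I. P i x"] by simp
qed (auto simp: homogeneous_poly_def intro!: exI[of _ "\<lambda>_. 0"])

lemma homogeneous_poly_monomial:
  assumes "\<alpha> \<in> exponents d"
  shows "homogeneous_poly d (monomial \<alpha>)"
  unfolding homogeneous_poly_def
proof (intro exI[of _ "\<lambda>\<beta>. if \<beta> = \<alpha> then 1 else 0"] allI)
  fix x
  have "(\<Sum>\<beta>\<in>exponents d. (if \<beta> = \<alpha> then 1 else 0) * monomial \<beta> x)
      = (\<Sum>\<beta>\<in>exponents d. if \<beta> = \<alpha> then monomial \<beta> x else 0)"
    by (intro sum.cong) auto
  then show "monomial \<alpha> x = (\<Sum>\<beta>\<in>exponents d. (if \<beta> = \<alpha> then 1 else 0) * monomial \<beta> x)"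
    using assms by (simp add: sum.delta')
qed

lemma monomial_mult: "monomial \<alpha> x * monomial \<beta> x = monomial (\<lambda>i. \<alpha> i + \<beta> i) x"
  by (simp add: monomial_def prod.distrib power_add)

lemma homogeneous_poly_mult:
  assumes "homogeneous_poly d P" "homogeneous_poly e Q"
  shows "homogeneous_poly (d + e) (\<lambda>x. P x * Q x)"
proof -
  obtain c where c: "\<And>x. P x = (\<Sum>\<alpha>\<in>exponents d. c \<alpha> * monomial \<alpha> x)"
    using assms(1) unfolding homogeneous_poly_def by blast
  obtain k where k: "\<And>x. Q x = (\<Sum>\<alpha>\<in>exponents e. k \<alpha> * monomial \<alpha> x)"
    using assms(2) unfolding homogeneous_poly_def by blast
  have "(\<lambda>x. P x * Q x) = (\<lambda>x. \<Sum>\<alpha>\<in>exponents d. \<Sum>\<beta>\<in>exponents e.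
          (c \<alpha> * k \<beta>) * monomial (\<lambda>i. \<alpha> i + \<beta> i) x)"
    by (simp add: c k sum_product flip: monomial_mult) (simp add: mult_ac)
  moreover have "homogeneous_poly (d + e) \<dots>"
    by (intro homogeneous_poly_sum homogeneous_poly_cmult homogeneous_poly_monomial)
       (auto simp: exponents_def sum.distrib)
  ultimately show ?thesis by simp
qed

lemma homogeneous_poly_one: "homogeneous_poly 0 (\<lambda>x :: complex ^ 'n::finite. 1)"
proof -
  have "homogeneous_poly 0 (monomial (\<lambda>_ :: 'n. 0))"
    by (rule homogeneous_poly_monomial) (simp add: exponents_def)
  moreover have "monomial (\<lambda>_ :: 'n. 0) = (\<lambda>x. 1)"
    by (simp add: monomial_def fun_eq_iff)
  ultimately show ?thesis by simp
qed

lemma homogeneous_poly_power: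
  assumes "homogeneous_poly d P"
  shows "homogeneous_poly (k * d) (\<lambda>x. P x ^ k)"
proof (induction k)
  case 0
  show ?case by (simp add: homogeneous_poly_one)
next
  case (Suc k)
  show ?case using homogeneous_poly_mult[OF assms Suc] by simp
qed

lemma homogeneous_poly_prod:
  assumes "finite I" "\<And>i. i \<in> I \<Longrightarrow> homogeneous_poly (d i) (P i)"
  shows "homogeneous_poly (\<Sum>i\<in>I. d i) (\<lambda>x. \<Prod>i\<in>I. P i x)"
  using assms
proof (induction I rule: finite_induct)
  case empty
  show ?case by (simp add: homogeneous_poly_one)
next
  case (insert i I)
  then show ?case
    using homogeneous_poly_mult[of "d i" "P i" "\<Sum>i\<in>I. d i" "\<lambda>x. \<Prod>i\<in>I. P i x"] by simp
qed

lemma homogeneous_poly_coord: "homogeneous_poly 1 (\<lambda>x. x $ i)"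
proof -
  have "monomial (\<lambda>j. if j = i then 1 else 0) x = x $ i" for x
  proof -
    have "monomial (\<lambda>j. if j = i then 1 else 0) x = (\<Prod>j\<in>UNIV. if j = i then x $ j else 1)"
      unfolding monomial_def by (intro prod.cong) auto
    then show ?thesis by simp
  qed
  then have "(\<lambda>x. x $ i) = monomial (\<lambda>j. if j = i then 1 else 0)"
    by (simp add: fun_eq_iff)
  moreover have "homogeneous_poly 1 (monomial (\<lambda>j. if j = i then 1 else 0))"
    by (rule homogeneous_poly_monomial) (simp add: exponents_def)
  ultimately show ?thesis by simp
qed

lemma homogeneous_poly_compose_linear:
  fixes A :: "complex ^ 'n::finite ^ 'n"
  assumes "homogeneous_poly d P"
  shows "homogeneous_poly d (\<lambda>x. P (A *v x))"
proof -
  obtain c where c: "\<And>x. P x = (\<Sum>\<alpha>\<in>exponents d. c \<alpha> * monomial \<alpha> x)"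
    using assms unfolding homogeneous_poly_def by blast
  have lin: "homogeneous_poly 1 (\<lambda>x. (A *v x) $ i)" for i
    unfolding matrix_vector_mult_def
    by (simp, intro homogeneous_poly_sum homogeneous_poly_cmult)
       (use homogeneous_poly_coord in simp)
  have "homogeneous_poly d (\<lambda>x. monomial \<alpha> (A *v x))" if "\<alpha> \<in> exponents d" for \<alpha>
  proof -
    have "homogeneous_poly (\<Sum>i\<in>UNIV. \<alpha> i * 1) (\<lambda>x. \<Prod>i\<in>UNIV. (A *v x) $ i ^ \<alpha> i)"
      by (intro homogeneous_poly_prod homogeneous_poly_power lin) simp
    then show ?thesis using that by (simp add: monomial_def exponents_def)
  qed
  then show ?thesis unfolding c
    by (intro homogeneous_poly_sum homogeneous_poly_cmult)
qed

lemma monomials_independent_aux: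
  fixes c :: "('n \<Rightarrow> nat) \<Rightarrow> complex"
  assumes "finite T"
  shows "finite S \<Longrightarrow> (\<And>\<alpha> \<beta>. \<alpha> \<in> S \<Longrightarrow> \<beta> \<in> S \<Longrightarrow> (\<forall>i\<in>T. \<alpha> i = \<beta> i) \<Longrightarrow> \<alpha> = \<beta>) \<Longrightarrow>
    (\<And>x. (\<Sum>\<alpha>\<in>S. c \<alpha> * (\<Prod>i\<in>T. x i ^ \<alpha> i)) = 0) \<Longrightarrow> \<alpha> \<in> S \<Longrightarrow> c \<alpha> = 0"
  using assms
proof (induction T arbitrary: S \<alpha> rule: finite_induct)
  case empty
  have "S = {\<alpha>}" using empty by blast
  then show ?case using empty(3) by simp
next
  case (insert j T)
  define N where "N = Max ((\<lambda>\<alpha>. \<alpha> j) ` S)"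
  have N: "\<beta> j \<le> N" if "\<beta> \<in> S" for \<beta>
    unfolding N_def using that insert.prems(1) by auto
  define S' where "S' = {\<beta>\<in>S. \<beta> j = \<alpha> j}"
  have vanish: "(\<Sum>\<beta>\<in>S'. c \<beta> * (\<Prod>i\<in>T. x i ^ \<beta> i)) = 0" for x
  proof -
    define e where "e n = (\<Sum>\<beta>\<in>{\<beta>\<in>S. \<beta> j = n}. c \<beta> * (\<Prod>i\<in>T. x i ^ \<beta> i))" for n
    have "(\<Sum>n\<le>N. e n * t ^ n) = 0" for t
    proof -
      have "(\<Sum>n\<le>N. e n * t ^ n) =
          (\<Sum>n\<le>N. \<Sum>\<beta>\<in>{\<beta>\<in>S. \<beta> j = n}. c \<beta> * (\<Prod>i\<in>T. x i ^ \<beta> i) * t ^ \<beta> j)"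
        unfolding e_def by (simp add: sum_distrib_right)
      also have "\<dots> = (\<Sum>\<beta>\<in>S. c \<beta> * (\<Prod>i\<in>T. x i ^ \<beta> i) * t ^ \<beta> j)"
        by (rule sum.group) (use insert.prems(1) N in auto)
      also have "\<dots> = (\<Sum>\<beta>\<in>S. c \<beta> * (\<Prod>i\<in>insert j T. (x(j := t)) i ^ \<beta> i))"
      proof (intro sum.cong refl)
        fix \<beta> assume "\<beta> \<in> S"
        have "(\<Prod>i\<in>T. (x(j := t)) i ^ \<beta> i) = (\<Prod>i\<in>T. x i ^ \<beta> i)"
          using insert.hyps by (intro prod.cong) auto
        then show "c \<beta> * (\<Prod>i\<in>T. x i ^ \<beta> i) * t ^ \<beta> j
            = c \<beta> * (\<Prod>i\<in>insert j T. (x(j := t)) i ^ \<beta> i)"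
          using insert.hyps by simp
      qed
      also have "\<dots> = 0" by (rule insert.prems(3))
      finally show ?thesis .
    qed
    then have "e n = 0" if "n \<le> N" for n
      using polyfun_eq_0[of e N] that by blast
    then show ?thesis using N[OF insert.prems(4)] unfolding e_def S'_def by blast
  qed
  show ?case
  proof (rule insert.IH)
    show "finite S'" using insert.prems(1) by (simp add: S'_def)
    show "\<beta> = \<gamma>" if "\<beta> \<in> S'" "\<gamma> \<in> S'" "\<forall>i\<in>T. \<beta> i = \<gamma> i" for \<beta> \<gamma>
      using that insert.prems(2)[of \<beta> \<gamma>] by (simp add: S'_def)
    show "(\<Sum>\<beta>\<in>S'. c \<beta> * (\<Prod>i\<in>T. x i ^ \<beta> i)) = 0" for x by (rule vanish)
    show "\<alpha> \<in> S'" using insert.prems(4) by (simp add: S'_def)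
  qed
qed

lemma monomials_independent:
  fixes c :: "('n::finite \<Rightarrow> nat) \<Rightarrow> complex"
  assumes "\<And>x. (\<Sum>\<alpha>\<in>exponents d. c \<alpha> * monomial \<alpha> x) = 0" "\<alpha> \<in> exponents d"
  shows "c \<alpha> = 0"
proof (rule monomials_independent_aux[of UNIV "exponents d" c \<alpha>])
  show "(\<Sum>\<alpha>\<in>exponents d. c \<alpha> * (\<Prod>i\<in>UNIV. x i ^ \<alpha> i)) = 0" for x
    using assms(1)[of "\<chi> i. x i"] by (simp add: monomial_def)
qed (use assms(2) in \<open>auto simp: fun_eq_iff\<close>)

text \<open>The coordinates are indexed by the numeral type 5, whose elements are 0, 1, 2, 3, 4.
  A quintic form is its vector of coefficients, so that the space of forms is a Euclidean
  space and carries the usual topology of a finite-dimensional complex vector space; an orbit has the same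
  closure in it as in the Zariski topology.\<close>

typedef quintic_exponent = "exponents 5 :: (5 \<Rightarrow> nat) set"
  by (rule exI[of _ "\<lambda>_. 1"]) (simp add: exponents_def)

instance quintic_exponent :: finite
proof
  have "(UNIV :: quintic_exponent set) = Abs_quintic_exponent ` exponents 5"
    using type_definition.Abs_image[OF type_definition_quintic_exponent] by simp
  then show "finite (UNIV :: quintic_exponent set)"
    by (metis finite_exponents finite_imageI)
qed

type_synonym quintic_form = "complex ^ quintic_exponent"

definition form_eval :: "quintic_form \<Rightarrow> complex ^ 5 \<Rightarrow> complex" where
  "form_eval F x = (\<Sum>\<alpha>\<in>UNIV. F $ \<alpha> * monomial (Rep_quintic_exponent \<alpha>) x)"

lemma sum_quintic_exponent:
  "(\<Sum>\<alpha>\<in>exponents 5. g \<alpha>) = (\<Sum>\<alpha>\<in>UNIV. g (Rep_quintic_exponent \<alpha>))"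
  by (rule sum.reindex_bij_betw[symmetric])
     (auto simp: bij_betw_def inj_on_def Rep_quintic_exponent_inject
       type_definition.Rep_range[OF type_definition_quintic_exponent])

lemma form_eval_eq:
  "form_eval F x = (\<Sum>\<alpha>\<in>exponents 5. F $ Abs_quintic_exponent \<alpha> * monomial \<alpha> x)"
  by (simp add: form_eval_def sum_quintic_exponent Rep_quintic_exponent_inverse)

lemma homogeneous_poly_form_eval: "homogeneous_poly 5 (form_eval F)"
  unfolding homogeneous_poly_def form_eval_eq
  by (rule exI[of _ "\<lambda>\<alpha>. F $ Abs_quintic_exponent \<alpha>"]) simp

lemma homogeneous_poly_5_imp_form:
  assumes "homogeneous_poly 5 P"
  shows "\<exists>F. \<forall>x. form_eval F x = P x"
proof -
  obtain c where c: "\<And>x. P x = (\<Sum>\<alpha>\<in>exponents 5. c \<alpha> * monomial \<alpha> x)"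
    using assms unfolding homogeneous_poly_def by blast
  show ?thesis
    by (rule exI[of _ "\<chi> \<alpha>. c (Rep_quintic_exponent \<alpha>)"])
       (simp add: c form_eval_def sum_quintic_exponent)
qed

lemma form_eval_inject:
  assumes "\<And>x. form_eval F x = form_eval G x"
  shows "F = G"
proof -
  have *: "(F - G) $ Abs_quintic_exponent \<alpha> = 0" if "\<alpha> \<in> exponents 5" for \<alpha>
  proof (rule monomials_independent[OF _ that])
    show "(\<Sum>\<alpha>\<in>exponents 5. (F - G) $ Abs_quintic_exponent \<alpha> * monomial \<alpha> x) = 0" for x
      using assms[of x] by (simp add: form_eval_eq left_diff_distrib sum_subtractf)
  qed
  have "F $ \<alpha> = G $ \<alpha>" for \<alpha>
    using *[OF Rep_quintic_exponent[of \<alpha>]] by (simp add: Rep_quintic_exponent_inverse)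
  then show ?thesis by (simp add: vec_eq_iff)
qed

text \<open>Substitution is a right action of the matrices; its orbits are those of the
  left action by the inverse matrices.\<close>

definition change_coords :: "complex ^ 5 ^ 5 \<Rightarrow> quintic_form \<Rightarrow> quintic_form" where
  "change_coords A F = (THE G. \<forall>x. form_eval G x = form_eval F (A *v x))"

lemma form_eval_change_coords: "form_eval (change_coords A F) x = form_eval F (A *v x)"
proof -
  have "\<exists>!G. \<forall>x. form_eval G x = form_eval F (A *v x)"
  proof (rule ex_ex1I)
    show "\<exists>G. \<forall>x. form_eval G x = form_eval F (A *v x)"
      by (intro homogeneous_poly_5_imp_form homogeneous_poly_compose_linear
          homogeneous_poly_form_eval)
  qed (auto intro: form_eval_inject)
  from theI'[OF this] show ?thesis unfolding change_coords_def by blast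
qed

definition SL_orbit :: "quintic_form \<Rightarrow> quintic_form set" where
  "SL_orbit F = {change_coords A F | A. det A = 1}"

definition SL_invariant :: "(quintic_form \<Rightarrow> complex) \<Rightarrow> bool" where
  "SL_invariant P \<longleftrightarrow> (\<forall>A F. det A = 1 \<longrightarrow> P (change_coords A F) = P F)"

definition semistable :: "quintic_form \<Rightarrow> bool" where
  "semistable F \<longleftrightarrow> (\<exists>d P. d > 0 \<and> homogeneous_poly d P \<and> SL_invariant P \<and> P F \<noteq> 0)"

definition unstable :: "quintic_form \<Rightarrow> bool" where
  "unstable F \<longleftrightarrow> \<not> semistable F"

definition equation_up_to_coords :: "quintic_form \<Rightarrow> (complex ^ 5 \<Rightarrow> complex) \<Rightarrow> bool" where
  "equation_up_to_coords F p \<longleftrightarrow> (\<exists>A. invertible A \<and> (\<forall>x. form_eval (change_coords A F) x = p x))"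

definition SS1_I :: "quintic_form \<Rightarrow> bool" where
  "SS1_I F \<longleftrightarrow> (\<exists>a b. a \<noteq> 0 \<and> b \<noteq> 0 \<and> equation_up_to_coords F
     (\<lambda>x. a * ((x$0)^2 * x$2 * (x$4)^2) + b * (x$0 * x$1 * x$2 * x$3 * x$4)))"

definition SS2_I :: "quintic_form \<Rightarrow> bool" where
  "SS2_I F \<longleftrightarrow> (\<exists>a b. a \<noteq> 0 \<and> b \<noteq> 0 \<and> equation_up_to_coords F
     (\<lambda>x. a * (x$0 * x$1 * x$2 * x$3 * x$4) + b * ((x$1)^2 * x$2 * (x$3)^2)))"

definition US1_I :: "quintic_form \<Rightarrow> bool" where
  "US1_I F \<longleftrightarrow> (\<exists>a. a \<noteq> 0 \<and> equation_up_to_coords F (\<lambda>x. a * ((x$0)^2 * x$2 * (x$4)^2)))"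

definition US2_I :: "quintic_form \<Rightarrow> bool" where
  "US2_I F \<longleftrightarrow> (\<exists>a. a \<noteq> 0 \<and> equation_up_to_coords F (\<lambda>x. a * ((x$1)^2 * x$2 * (x$3)^2)))"

definition MO2_V :: "quintic_form \<Rightarrow> bool" where
  "MO2_V F \<longleftrightarrow> (\<exists>a. a \<noteq> 0 \<and> equation_up_to_coords F (\<lambda>x. a * (x$0 * x$1 * x$2 * x$3 * x$4)))"

definition degenerates_to_MO2_V :: "quintic_form \<Rightarrow> bool" where
  "degenerates_to_MO2_V F \<longleftrightarrow> (\<exists>G \<in> closure (SL_orbit F). MO2_V G)"

end

theory Submission
  imports Defs
begin

text \<open>
  Write u for the product of the coordinates 0 and 4, v for that of 1 and 3, and z for coordinate 2.
  A monomial of type US is scaled by a diagonal matrix of determinant 1, so every invariant vanishes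
  at it. A form of type SS1 is z u (a u + b v); a one-parameter subgroup removes its first term. The
  limit z u v is not in the orbit: it is a product of five linear forms, which cannot vanish on the
  irreducible quadric a u + b v = 0 without one of them being zero. US2 and SS2 are obtained by
  exchanging u and v.

  Closedness is a compactness argument. Given a convergent sequence in the orbit, normalise the
  factors of its members and pass to a subsequence along which they converge. If the limits are
  nonzero, then so is their product, and the accumulated scalars converge too. For z u v the
  limiting linear forms are independent because the determinant persists. The remaining forms are
  a z (u - r v) (u - s v) with a, r, s nonzero, and the quantity to be tracked is the determinant of
  a quadric plus the square of the linear factor. If r and s differ, normalise u and v jointly: the
  determinant keeps both quadrics away from zero, so the matrices themselves converge up to rescaling
  coordinate 2. If r = s, normalise the quadric; the limit still has rank 4 and is brought back to the
  original quadric by an orthonormal basis of a nondegenerate symmetric bilinear form.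
\<close>

subsection \<open>Unstable and non-closed orbits\<close>

lemma UNIV_5: "(UNIV :: 5 set) = {0,1,2,3,4}"
proof -
  have "card {0,1,2,3,4::5} = 5" by simp
  then show ?thesis using card_subset_eq[of "UNIV::5 set" "{0,1,2,3,4}"] by simp
qed

lemma forall_5: "(\<forall>i::5. P i) \<longleftrightarrow> P 0 \<and> P 1 \<and> P 2 \<and> P 3 \<and> P 4"
  using UNIV_5 by (metis UNIV_I empty_iff insert_iff)

lemma sum_5: "sum f (UNIV::5 set) = f 0 + f 1 + f 2 + f 3 + f 4"
  unfolding UNIV_5 by (simp add: add.assoc)

lemma prod_5: "prod f (UNIV::5 set) = f 0 * f 1 * f 2 * f 3 * f 4"
  unfolding UNIV_5 by (simp add: mult.assoc)

definition diag :: "('n::finite \<Rightarrow> complex) \<Rightarrow> complex ^ 'n ^ 'n" where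
  "diag c = (\<chi> i j. if i = j then c i else 0)"

lemma diag_mult_nth [simp]: "(diag c *v x) $ i = c i * x $ i"
  by (simp add: diag_def matrix_vector_mult_def if_distrib[of "\<lambda>y. y * _"] cong: if_cong)

lemma det_diag [simp]: "det (diag c) = prod c UNIV"
  by (simp add: diag_def det_diagonal)

lemma equation_up_to_coordsE:
  assumes "equation_up_to_coords F p"
  obtains A A' where "A ** A' = mat 1" "A' ** A = mat 1"
    "\<And>x. form_eval F (A *v x) = p x" "\<And>x. form_eval F x = p (A' *v x)"
proof -
  obtain A A' where A: "A ** A' = mat 1" "A' ** A = mat 1"
    and F: "\<And>x. form_eval F (A *v x) = p x"
    using assms unfolding equation_up_to_coords_def form_eval_change_coords invertible_def by blast
  have "form_eval F x = p (A' *v x)" for x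
    using F[of "A' *v x"] A(1) by (simp add: matrix_vector_mul_assoc)
  with A F that show ?thesis by blast
qed

lemma equation_up_to_coords_comp:
  assumes "equation_up_to_coords F p" "invertible C" "\<And>x. q x = p (C *v x)"
  shows "equation_up_to_coords F q"
proof -
  obtain A where "invertible A" "\<And>x. form_eval F (A *v x) = p x"
    using assms(1) unfolding equation_up_to_coords_def form_eval_change_coords by blast
  then show ?thesis
    unfolding equation_up_to_coords_def form_eval_change_coords
    using assms(2,3) invertible_mult[of A C] by (metis matrix_vector_mul_assoc)
qed

text \<open>A substitution in the coordinates of a normal form becomes, after conjugation, a
  substitution in the original ones. Conjugation keeps determinant 1 although the coordinate change
  \<open>A\<close> itself need not have it.\<close>

lemma det_conj_eq_1:
  fixes A A' B :: "complex ^ 'n::finite ^ 'n"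
  assumes "A ** A' = mat 1" "det B = 1"
  shows "det (A ** B ** A') = 1"
proof -
  have "det A * det A' = 1" using assms(1) by (metis det_I det_mul)
  then show ?thesis using assms(2) by (simp add: det_mul mult_ac)
qed

text \<open>The involution carries the pair of indices 0, 4 to the pair 1, 3 and fixes 2, so it
  exchanges u and v.\<close>

definition swap_perm :: "5 \<Rightarrow> 5" where
  "swap_perm = id(0 := 1, 1 := 0, 3 := 4, 4 := 3)"

definition swap_coords :: "complex ^ 5 ^ 5" where
  "swap_coords = (\<chi> i j. if j = swap_perm i then 1 else 0)"

lemma swap_coords_nth [simp]: "(swap_coords *v x) $ i = x $ swap_perm i"
  by (simp add: swap_coords_def matrix_vector_mult_def if_distrib[of "\<lambda>y. y * _"] cong: if_cong)

lemma invertible_swap_coords: "invertible swap_coords"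
proof -
  have "swap_perm (swap_perm i) = i" for i by (simp add: swap_perm_def)
  then have "swap_coords *v (swap_coords *v x) = x" for x
    by (simp add: vec_eq_iff)
  then have "swap_coords ** swap_coords = mat 1"
    by (simp add: matrix_eq flip: matrix_vector_mul_assoc)
  then show ?thesis unfolding invertible_def by blast
qed

lemma US2_I_imp_US1_I:
  assumes "US2_I F"
  shows "US1_I F"
proof -
  obtain a where "a \<noteq> 0" "equation_up_to_coords F (\<lambda>x. a * ((x$1)^2 * x$2 * (x$3)^2))"
    using assms unfolding US2_I_def by blast
  from equation_up_to_coords_comp[OF this(2) invertible_swap_coords]
  have "equation_up_to_coords F (\<lambda>x. a * ((x$0)^2 * x$2 * (x$4)^2))"
    by (simp add: swap_perm_def)
  with \<open>a \<noteq> 0\<close> show ?thesis unfolding US1_I_def by blast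
qed

lemma SS2_I_imp_SS1_I:
  assumes "SS2_I F"
  shows "SS1_I F"
proof -
  obtain a b where "a \<noteq> 0" "b \<noteq> 0" "equation_up_to_coords F
     (\<lambda>x. a * (x$0 * x$1 * x$2 * x$3 * x$4) + b * ((x$1)^2 * x$2 * (x$3)^2))"
    using assms unfolding SS2_I_def by blast
  from equation_up_to_coords_comp[OF this(3) invertible_swap_coords]
  have "equation_up_to_coords F
     (\<lambda>x. b * ((x$0)^2 * x$2 * (x$4)^2) + a * (x$0 * x$1 * x$2 * x$3 * x$4))"
    by (simp add: swap_perm_def algebra_simps)
  with \<open>a \<noteq> 0\<close> \<open>b \<noteq> 0\<close> show ?thesis unfolding SS1_I_def by blast
qed

section \<open>Scalars, invariants and instability\<close>

lemma form_eval_scale: "form_eval (c *s F) x = c * form_eval F x"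
  by (simp add: form_eval_def sum_distrib_left mult.assoc)

lemma form_eval_plus: "form_eval (F + G) x = form_eval F x + form_eval G x"
  by (simp add: form_eval_def sum.distrib distrib_right)

lemma homogeneous_poly_scale:
  assumes "homogeneous_poly d P"
  shows "P (c *s x) = c ^ d * P x"
proof -
  obtain k where k: "\<And>x. P x = (\<Sum>\<alpha>\<in>exponents d. k \<alpha> * monomial \<alpha> x)"
    using assms unfolding homogeneous_poly_def by blast
  have "monomial \<alpha> (c *s x) = c ^ d * monomial \<alpha> x" if "\<alpha> \<in> exponents d" for \<alpha>
    using that by (simp add: monomial_def exponents_def power_mult_distrib prod.distrib
        flip: power_sum)
  then show ?thesis by (simp add: k sum_distrib_left mult_ac)
qed

lemma US1_I_imp_unstable:
  assumes "US1_I F"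
  shows "unstable F"
proof -
  obtain a where "equation_up_to_coords F (\<lambda>x. a * ((x$0)^2 * x$2 * (x$4)^2))"
    using assms unfolding US1_I_def by blast
  from equation_up_to_coordsE[OF this] obtain A A' :: "complex^5^5" where A: "A ** A' = mat 1" "A' ** A = mat 1"
    and F: "\<And>x. form_eval F (A *v x) = a * ((x$0)^2 * x$2 * (x$4)^2)"
      "\<And>x. form_eval F x = a * (((A' *v x)$0)^2 * (A' *v x)$2 * ((A' *v x)$4)^2)"
    by blast
  \<comment> \<open>The determinant is 4^3 / 8^2 = 1, while the monomial has degree 5 in the
    coordinates 0, 2, 4 alone and is multiplied by 4^5 = 1024.\<close>
  define D where "D = diag (\<lambda>i::5. if i = 1 \<or> i = 3 then 1/8 else 4)"
  have "det D = 1" by (simp add: D_def prod_5)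
  then have det: "det (A ** D ** A') = 1" by (rule det_conj_eq_1[OF A(1)])
  have A'A: "A' *v (A *v x) = x" for x using A(2) by (simp add: matrix_vector_mul_assoc)
  have eq: "change_coords (A ** D ** A') F = 1024 *s F"
    by (rule form_eval_inject)
       (simp add: form_eval_change_coords form_eval_scale F(2) A'A flip: matrix_vector_mul_assoc,
        simp add: D_def power2_eq_square)
  have "P F = 0" if "d > 0" "homogeneous_poly d P" "SL_invariant P" for d P
  proof -
    have "P F = P (1024 *s F)" using that(3) det eq unfolding SL_invariant_def by metis
    also have "\<dots> = 1024 ^ d * P F" by (rule homogeneous_poly_scale[OF that(2)])
    finally have "P F = 0 \<or> (1024::complex) ^ d = 1" by simp
    moreover have "norm ((1024::complex) ^ d) > 1"
      using that(1) by (simp add: norm_power one_less_power)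
    ultimately show ?thesis by force
  qed
  then show ?thesis unfolding unstable_def semistable_def by blast
qed

section \<open>Degeneration of SS1 to the product of the coordinates\<close>

lemma continuous_form_eval:
  assumes "X \<longlonglongrightarrow> G"
  shows "(\<lambda>n. form_eval (X n) x) \<longlonglongrightarrow> form_eval G x"
  unfolding form_eval_def by (intro tendsto_intros assms)

text \<open>The quadric contains a polynomial curve whose five coordinates are linearly independent.
  Along it the product of the linear forms is a zero polynomial in one variable, so one form
  vanishes on the curve and is therefore zero. The integrality of the univariate polynomials thus
  stands in for the irreducibility of the quadric.\<close>

lemma linear_factor_vanishes:
  fixes C :: "complex ^ 5 ^ 5"
  assumes "\<And>x. a * (x$0 * x$4) + b * (x$1 * x$3) = 0 \<Longrightarrow> (\<Prod>i\<in>UNIV. (C *v x) $ i) = 0"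
    and "a \<noteq> 0" "b \<noteq> 0"
  shows "\<not> invertible C"
proof -
  \<comment> \<open>On this curve the two terms of the quadric are - a b t^3 and a b t^3. The powers
    1, t, ..., t^4 occur in one coordinate each, so the coefficients of \<open>p i\<close> are the
    entries of row i up to nonzero factors.\<close>
  define xt where "xt t = (\<chi> i::5. if i = 0 then - b else if i = 1 then a * t else if i = 2 then t^4
      else if i = 3 then t^2 else t^3)" for t
  define p where "p i = [: - b * C$i$0, a * C$i$1, C$i$3, C$i$4, C$i$2 :]" for i
  have p: "(C *v xt t) $ i = poly (p i) t" for i t
    by (simp add: matrix_vector_mult_def sum_5 xt_def p_def algebra_simps eval_nat_numeral)
  have "poly (\<Prod>i\<in>UNIV. p i) t = 0" for t
    using assms(1)[of "xt t"] p
    by (simp add: poly_prod) (simp add: xt_def eval_nat_numeral)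
  then have "(\<Prod>i\<in>UNIV. p i) = 0" using poly_all_0_iff_0 by blast
  then obtain i where "p i = 0" by auto
  then have "C $ i = 0"
    using assms(2,3) by (simp add: p_def vec_eq_iff forall_5)
  then have "det C = 0" by (intro det_zero_row) (auto simp: row_def vec_eq_iff)
  then show ?thesis by (simp add: invertible_det_nz)
qed

lemma homogeneous_poly_coord_prod:
  "homogeneous_poly 5 (\<lambda>x::complex^5. x $ i * x $ j * x $ k * x $ l * x $ m)"
proof -
  have "homogeneous_poly (1 + 1 + 1 + 1 + 1) (\<lambda>x::complex^5. x $ i * x $ j * x $ k * x $ l * x $ m)"
    by (intro homogeneous_poly_mult homogeneous_poly_coord)
  then show ?thesis by (simp add: numeral_eq_Suc)
qed

lemma SS1_I_imp:
  assumes "SS1_I F"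
  shows "\<not> closed (SL_orbit F)" "degenerates_to_MO2_V F"
proof -
  obtain a b where ab: "a \<noteq> 0" "b \<noteq> 0" and "equation_up_to_coords F
     (\<lambda>x. a * ((x$0)^2 * x$2 * (x$4)^2) + b * (x$0 * x$1 * x$2 * x$3 * x$4))"
    using assms unfolding SS1_I_def by blast
  define m where "m x = x$0 * x$1 * x$2 * x$3 * x$4" for x :: "complex^5"
  define h where "h x = x$0 * x$0 * x$2 * x$4 * x$4" for x :: "complex^5"
  have "equation_up_to_coords F (\<lambda>x. a * h x + b * m x)"
    using \<open>equation_up_to_coords F _\<close> by (simp add: power2_eq_square mult.assoc h_def m_def)
  from equation_up_to_coordsE[OF this] obtain A A' :: "complex^5^5" where A: "A ** A' = mat 1" "A' ** A = mat 1"
    and F: "\<And>x. form_eval F (A *v x) = a * h x + b * m x"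
      "\<And>x. form_eval F x = a * h (A' *v x) + b * m (A' *v x)"
    by blast
  have hom: "homogeneous_poly 5 (\<lambda>x. a * h (A' *v x))" "homogeneous_poly 5 (\<lambda>x. b * m (A' *v x))"
    unfolding h_def m_def
    using homogeneous_poly_compose_linear[OF homogeneous_poly_cmult[OF homogeneous_poly_coord_prod]]
    by blast+
  then obtain G H where G: "\<And>x. form_eval G x = b * m (A' *v x)"
    and H: "\<And>x. form_eval H x = a * h (A' *v x)"
    using homogeneous_poly_5_imp_form by metis
  have A'A: "A' *v (A *v x) = x" for x using A(2) by (simp add: matrix_vector_mul_assoc)
  have orbit: "G + of_real (t^2) *s H \<in> SL_orbit F" if "t > 0" for t :: real
  proof -
    \<comment> \<open>The scalings of coordinates 0 and 1 cancel in \<open>m\<close>, whereas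
      \<open>h\<close> contains coordinate 0 twice and coordinate 1 not at all. Letting t tend to 0
      removes \<open>h\<close>.\<close>
    define D where "D = diag (\<lambda>i::5. if i = 0 then of_real t else if i = 1 then 1 / of_real t else 1)"
    have "det D = 1" using that by (simp add: D_def prod_5)
    then have det: "det (A ** D ** A') = 1" by (rule det_conj_eq_1[OF A(1)])
    have "change_coords (A ** D ** A') F = G + of_real (t^2) *s H"
    proof (rule form_eval_inject)
      fix x
      have "m (D *v y) = m y" "h (D *v y) = of_real (t^2) * h y" for y
        using that by (simp_all add: D_def m_def h_def power2_eq_square)
      then show "form_eval (change_coords (A ** D ** A') F) x
          = form_eval (G + of_real (t^2) *s H) x"
        by (simp add: form_eval_change_coords form_eval_plus form_eval_scale F G H A'A
            flip: matrix_vector_mul_assoc)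
    qed
    with det show ?thesis unfolding SL_orbit_def by force
  qed
  have "(\<lambda>n. G + of_real ((inverse (real (Suc n)))^2) *s H) \<longlonglongrightarrow> G"
  proof (rule vec_tendstoI)
    fix i
    have "(\<lambda>n. G $ i + of_real ((inverse (real (Suc n)))^2) * H $ i) \<longlonglongrightarrow> G $ i + of_real (0^2) * H $ i"
      by (intro tendsto_intros LIMSEQ_inverse_real_of_nat)
    then show "(\<lambda>n. (G + of_real ((inverse (real (Suc n)))^2) *s H) $ i) \<longlonglongrightarrow> G $ i" by simp
  qed
  moreover have "\<forall>n. G + of_real ((inverse (real (Suc n)))^2) *s H \<in> SL_orbit F"
    by (intro allI orbit) simp
  ultimately have lim: "G \<in> closure (SL_orbit F)"
    unfolding closure_sequential by (intro exI conjI)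
  have "invertible A" using A unfolding invertible_def by blast
  moreover have "\<forall>x. form_eval (change_coords A G) x = b * m x"
    by (simp add: form_eval_change_coords G A'A)
  ultimately have "MO2_V G" unfolding MO2_V_def equation_up_to_coords_def m_def using ab by blast
  with lim show "degenerates_to_MO2_V F" unfolding degenerates_to_MO2_V_def by blast
  show "\<not> closed (SL_orbit F)"
  proof
    assume "closed (SL_orbit F)"
    with lim have "G \<in> SL_orbit F" by simp
    then obtain B where B: "det B = 1" "change_coords B F = G" unfolding SL_orbit_def by blast
    then have "invertible B" by (simp add: invertible_det_nz)
    then obtain B' where B': "B ** B' = mat 1" unfolding invertible_def by blast
    \<comment> \<open>If \<open>B\<close> carried F to its limit, then the inverse of
      \<open>B\<close>, read in the coordinates of the normal form, would turn \<open>b * m\<close>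
      into \<open>a * h + b * m\<close>. The latter would then be a multiple of the product of the
      linear forms given by the rows of \<open>C\<close>.\<close>
    define C where "C = A' ** B' ** A"
    have det: "det A' * det A = 1" using A(2) by (metis det_I det_mul)
    have "det B * det B' = 1" using B' by (metis det_I det_mul)
    then have "det B' = 1" using B by simp
    with det have "det C = 1" by (simp add: C_def det_mul)
    have eq: "a * h x + b * m x = b * m (C *v x)" for x
    proof -
      have "b * m (C *v x) = form_eval G (B' *v (A *v x))"
        by (simp add: G C_def flip: matrix_vector_mul_assoc)
      also have "\<dots> = form_eval F (B *v (B' *v (A *v x)))"
        using B(2) form_eval_change_coords by metis
      also have "\<dots> = a * h x + b * m x"
        using B' by (simp add: matrix_vector_mul_assoc matrix_mul_assoc flip: F(1))
      finally show ?thesis by simp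
    qed
    have "(\<Prod>i\<in>UNIV. (C *v x) $ i) = 0" if "a * (x$0 * x$4) + b * (x$1 * x$3) = 0" for x
    proof -
      have "a * h x + b * m x = x$0 * x$2 * x$4 * (a * (x$0 * x$4) + b * (x$1 * x$3))"
        by (simp add: h_def m_def algebra_simps)
      with that eq[of x] have "b * m (C *v x) = 0" by simp
      then show ?thesis using ab by (simp add: m_def prod_5)
    qed
    then have "\<not> invertible C" using linear_factor_vanishes ab by blast
    with \<open>det C = 1\<close> show False by (simp add: invertible_det_nz)
  qed
qed

text \<open>Convergent coefficient vectors give pointwise convergent values, and a form is
  determined by its values. Closedness can therefore be tested on pointwise limits of the normal
  form \<open>p\<close>, and conjugation moves the matrices to its coordinates.\<close>

lemma closed_orbitI:
  assumes "equation_up_to_coords F p"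
    and *: "\<And>A g. (\<And>n::nat. det (A n) = 1) \<Longrightarrow> (\<And>x. (\<lambda>n. p (A n *v x)) \<longlonglongrightarrow> g x)
      \<Longrightarrow> \<exists>B. det B = 1 \<and> (\<forall>x. g x = p (B *v x))"
  shows "closed (SL_orbit F)"
proof -
  obtain A A' where A: "A ** A' = mat 1" "A' ** A = mat 1"
    and F: "\<And>x. form_eval F (A *v x) = p x" "\<And>x. form_eval F x = p (A' *v x)"
    using equation_up_to_coordsE[OF assms(1)] by blast
  have AA': "A *v (A' *v x) = x" for x using A(1) by (simp add: matrix_vector_mul_assoc)
  show ?thesis unfolding closed_sequential_limits
  proof (intro allI impI; elim conjE)
    fix X G assume X: "\<forall>n. X n \<in> SL_orbit F" "X \<longlonglongrightarrow> G"
    then obtain T where T: "\<And>n. det (T n) = 1" "\<And>n. X n = change_coords (T n) F"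
      unfolding SL_orbit_def mem_Collect_eq by metis
    have "\<exists>B. det B = 1 \<and> (\<forall>x. form_eval G (A *v x) = p (B *v x))"
    proof (rule *)
      show "det (A' ** T n ** A) = 1" for n by (rule det_conj_eq_1[OF A(2) T(1)])
      show "(\<lambda>n. p ((A' ** T n ** A) *v x)) \<longlonglongrightarrow> form_eval G (A *v x)" for x
        using continuous_form_eval[OF X(2), of "A *v x"]
        by (simp add: T(2) form_eval_change_coords F(2) matrix_vector_mul_assoc matrix_mul_assoc)
    qed
    then obtain B where B: "det B = 1" "\<And>x. form_eval G (A *v x) = p (B *v x)" by blast
    have "G = change_coords (A ** B ** A') F"
      by (rule form_eval_inject)
         (metis AA' B(2) F(1) form_eval_change_coords matrix_vector_mul_assoc)
    then show "G \<in> SL_orbit F"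
      unfolding SL_orbit_def using det_conj_eq_1[OF A(1) B(1)] by blast
  qed
qed

subsection \<open>Limits of products of linear forms\<close>

lemma tendsto_mat_vec [tendsto_intros]:
  fixes X :: "_ \<Rightarrow> complex ^ 'n::finite ^ 'm::finite"
  assumes "(X \<longlongrightarrow> Y) G"
  shows "((\<lambda>n. X n *v x) \<longlongrightarrow> Y *v x) G"
  by (rule vec_tendstoI) (auto simp: matrix_vector_mult_def intro!: tendsto_intros assms)

lemma tendsto_mat_mult [tendsto_intros]:
  fixes X :: "_ \<Rightarrow> complex ^ 'n::finite ^ 'm::finite" and X' :: "_ \<Rightarrow> complex ^ 'k::finite ^ 'n"
  assumes "(X \<longlongrightarrow> Y) G" "(X' \<longlongrightarrow> Y') G"
  shows "((\<lambda>n. X n ** X' n) \<longlongrightarrow> Y ** Y') G"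
  by (intro vec_tendstoI) (auto simp: matrix_matrix_mult_def intro!: tendsto_intros assms)

lemma tendsto_transpose [tendsto_intros]:
  fixes X :: "_ \<Rightarrow> complex ^ 'n::finite ^ 'm::finite"
  assumes "(X \<longlongrightarrow> Y) G"
  shows "((\<lambda>n. transpose (X n)) \<longlongrightarrow> transpose Y) G"
  by (intro vec_tendstoI) (auto simp: transpose_def intro!: tendsto_intros assms)

lemma tendsto_det [tendsto_intros]:
  fixes X :: "_ \<Rightarrow> complex ^ 'n::finite ^ 'n"
  assumes "(X \<longlongrightarrow> Y) G"
  shows "((\<lambda>n. det (X n)) \<longlongrightarrow> det Y) G"
  unfolding det_def by (intro tendsto_intros assms)

text \<open>Restriction to lines reduces the integrality of the ring of polynomial functions to that
  of the univariate polynomials.\<close>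

definition poly_on_lines :: "(complex ^ 'n::finite \<Rightarrow> complex) \<Rightarrow> bool" where
  "poly_on_lines f \<longleftrightarrow> (\<forall>x y. \<exists>p. \<forall>t. f (x + t *s y) = poly p t)"

lemma poly_on_lines_mult:
  assumes "poly_on_lines f" "poly_on_lines g"
  shows "poly_on_lines (\<lambda>x. f x * g x)"
  unfolding poly_on_lines_def
proof (intro allI)
  fix x y
  obtain p where "\<And>t. f (x + t *s y) = poly p t"
    using assms(1) unfolding poly_on_lines_def by blast
  moreover obtain q where "\<And>t. g (x + t *s y) = poly q t"
    using assms(2) unfolding poly_on_lines_def by blast
  ultimately have "\<forall>t. f (x + t *s y) * g (x + t *s y) = poly (p * q) t" by simp
  then show "\<exists>p. \<forall>t. f (x + t *s y) * g (x + t *s y) = poly p t" by blast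
qed

lemma poly_on_lines_sum:
  assumes "\<And>i. i \<in> I \<Longrightarrow> poly_on_lines (f i)"
  shows "poly_on_lines (\<lambda>x. \<Sum>i\<in>I. f i x)"
  unfolding poly_on_lines_def
proof (intro allI)
  fix x y
  have "\<forall>i\<in>I. \<exists>p. \<forall>t. f i (x + t *s y) = poly p t"
    using assms unfolding poly_on_lines_def by blast
  from bchoice[OF this] obtain p where "\<forall>i\<in>I. \<forall>t. f i (x + t *s y) = poly (p i) t" by blast
  then have "\<forall>t. (\<Sum>i\<in>I. f i (x + t *s y)) = poly (\<Sum>i\<in>I. p i) t"
    by (simp add: poly_sum)
  then show "\<exists>p. \<forall>t. (\<Sum>i\<in>I. f i (x + t *s y)) = poly p t" by blast
qed

lemma poly_on_lines_coord: "poly_on_lines (\<lambda>x. x $ i)"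
  unfolding poly_on_lines_def
proof (intro allI)
  fix x y :: "complex ^ 'a"
  show "\<exists>p. \<forall>t. (x + t *s y) $ i = poly p t"
    by (rule exI[of _ "[: x $ i, y $ i :]"]) simp
qed

lemma poly_on_lines_mat_vec:
  fixes A :: "complex ^ 'n::finite ^ 'm::finite"
  shows "poly_on_lines (\<lambda>x. (A *v x) $ i)"
  unfolding poly_on_lines_def
proof (intro allI)
  fix x y
  show "\<exists>p. \<forall>t. (A *v (x + t *s y)) $ i = poly p t"
    by (rule exI[of _ "[: (A *v x) $ i, (A *v y) $ i :]"])
       (simp add: matrix_vector_right_distrib vector_scalar_commute)
qed

text \<open>On the line from x to y the first function is nonzero at parameter 0 and the second at
  parameter 1. The product of the two univariate polynomials is then nonzero and has a
  nonroot.\<close>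

lemma poly_on_lines_mult_nonzero:
  assumes "poly_on_lines f" "poly_on_lines g" "f x \<noteq> 0" "g y \<noteq> 0"
  obtains z where "f z \<noteq> 0" "g z \<noteq> 0"
proof -
  obtain p where p: "\<And>t. f (x + t *s (y - x)) = poly p t"
    using assms(1) unfolding poly_on_lines_def by blast
  obtain q where q: "\<And>t. g (x + t *s (y - x)) = poly q t"
    using assms(2) unfolding poly_on_lines_def by blast
  have "poly p 0 \<noteq> 0" "poly q 1 \<noteq> 0"
    using assms(3,4) p[of 0] q[of 1] by simp_all
  then have "p * q \<noteq> 0" by auto
  then obtain t where "poly (p * q) t \<noteq> 0" using poly_all_0_iff_0 by blast
  then have "f (x + t *s (y - x)) \<noteq> 0" "g (x + t *s (y - x)) \<noteq> 0" unfolding p q by simp_all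
  then show ?thesis by (rule that)
qed

lemma mat_vec_row_nonzero:
  fixes A :: "complex ^ 'n::finite ^ 'm::finite"
  assumes "A $ i \<noteq> 0"
  obtains x where "(A *v x) $ i \<noteq> 0"
proof -
  obtain j where j: "A $ i $ j \<noteq> 0" using assms by (auto simp: vec_eq_iff)
  have "(A *v axis j 1) $ i = A $ i $ j"
    by (simp add: matrix_vector_mult_def axis_def if_distrib[of "\<lambda>y. _ * y"] cong: if_cong)
  with j that show ?thesis by metis
qed

lemma poly_on_lines_prod:
  assumes "\<And>i. i \<in> I \<Longrightarrow> poly_on_lines (f i)"
  shows "poly_on_lines (\<lambda>x. \<Prod>i\<in>I. f i x)"
  unfolding poly_on_lines_def
proof (intro allI)
  fix x y
  have "\<forall>i\<in>I. \<exists>p. \<forall>t. f i (x + t *s y) = poly p t"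
    using assms unfolding poly_on_lines_def by blast
  from bchoice[OF this] obtain p where "\<forall>i\<in>I. \<forall>t. f i (x + t *s y) = poly (p i) t" by blast
  then have "\<forall>t. (\<Prod>i\<in>I. f i (x + t *s y)) = poly (\<Prod>i\<in>I. p i) t"
    by (simp add: poly_prod)
  then show "\<exists>p. \<forall>t. (\<Prod>i\<in>I. f i (x + t *s y)) = poly p t" by blast
qed

lemma all_coords_nonzero:
  fixes A :: "complex ^ 'n::finite ^ 'm::finite"
  assumes "\<And>i. A $ i \<noteq> 0"
  obtains x where "\<And>i. (A *v x) $ i \<noteq> 0"
proof -
  have "\<exists>x. (\<Prod>i\<in>I. (A *v x) $ i) \<noteq> 0" if "finite I" for I
    using that
  proof induction
    case (insert i I)
    obtain x where "(A *v x) $ i \<noteq> 0" using mat_vec_row_nonzero[OF assms] .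
    moreover obtain y where "(\<Prod>i\<in>I. (A *v y) $ i) \<noteq> 0" using insert.IH ..
    ultimately obtain z where "(A *v z) $ i \<noteq> 0" "(\<Prod>i\<in>I. (A *v z) $ i) \<noteq> 0"
      by (rule poly_on_lines_mult_nonzero[OF poly_on_lines_mat_vec[of A i]
          poly_on_lines_prod[of I "\<lambda>i x. (A *v x) $ i", OF poly_on_lines_mat_vec]])
    with insert.hyps show ?case by (intro exI[of _ z]) simp
  qed simp
  from this[OF finite_class.finite_UNIV]
  obtain x where "(\<Prod>i\<in>UNIV. (A *v x) $ i) \<noteq> 0" by blast
  then show ?thesis by (intro that[of x]) simp
qed

text \<open>The common last step when the matrices themselves converge after normalisation:
  \<open>X\<close> holds the normalised matrices and \<open>t\<close> the scalars divided out. One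
  point where the limiting form is nonzero makes \<open>t\<close> converge too.\<close>

lemma rescale_limit:
  fixes p :: "complex ^ 5 \<Rightarrow> complex"
  assumes X: "X \<longlonglongrightarrow> Y" and det: "\<And>n. t n * det (X n) = 1"
    and lim: "\<And>x. (\<lambda>n. t n * p (X n *v x)) \<longlonglongrightarrow> g x"
    and cont: "continuous_on UNIV p"
    and hom: "\<And>c y. p (diag (\<lambda>i. if i = 2 then c else 1) *v y) = c * p y"
    and nz: "p (Y *v z) \<noteq> 0"
  shows "\<exists>B. det B = 1 \<and> (\<forall>x. g x = p (B *v x))"
proof -
  have pX: "(\<lambda>n. p (X n *v x)) \<longlonglongrightarrow> p (Y *v x)" for x
    using cont by (intro isCont_tendsto_compose[of _ p] tendsto_intros X)
      (simp add: continuous_on_eq_continuous_at)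
  define \<tau> where "\<tau> = g z / p (Y *v z)"
  \<comment> \<open>Dividing by the value at \<open>z\<close> recovers \<open>t n\<close>, for all
    large n, since these values tend to a nonzero limit.\<close>
  have "(\<lambda>n. (t n * p (X n *v z)) / p (X n *v z)) \<longlonglongrightarrow> \<tau>"
    unfolding \<tau>_def by (intro tendsto_intros lim pX nz)
  moreover have "eventually (\<lambda>n. p (X n *v z) \<noteq> 0) sequentially"
    using pX nz by (rule tendsto_imp_eventually_ne)
  ultimately have t: "t \<longlonglongrightarrow> \<tau>"
    by (elim Lim_transform_eventually eventually_mono) simp
  have "(\<lambda>n. t n * det (X n)) \<longlonglongrightarrow> \<tau> * det Y" by (intro tendsto_intros t X)
  then have "\<tau> * det Y = 1" using det by (simp add: LIMSEQ_const_iff)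
  moreover have "g x = \<tau> * p (Y *v x)" for x
    using lim[of x] tendsto_mult[OF t pX[of x]] by (rule LIMSEQ_unique)
  ultimately show ?thesis
    \<comment> \<open>The form is linear in coordinate 2, so scaling that coordinate by
      \<open>\<tau>\<close> accounts for the scalar in the form and in the determinant
      alike.\<close>
    by (intro exI[of _ "diag (\<lambda>i. if i = 2 then \<tau> else 1) ** Y"])
       (simp add: det_mul prod_5 hom flip: matrix_vector_mul_assoc)
qed

section \<open>Compactness after scaling the rows\<close>

lemma bounded_range_subsequence:
  fixes X :: "nat \<Rightarrow> 'a::heine_borel"
  assumes "bounded (range X)"
  obtains Y \<sigma> where "strict_mono \<sigma>" "(\<lambda>n. X (\<sigma> n)) \<longlonglongrightarrow> Y"
  using bounded_imp_convergent_subsequence[OF assms] by (auto simp: o_def)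

lemma norm_rows_le_1_bounded:
  fixes X :: "nat \<Rightarrow> complex ^ 'n::finite ^ 'm::finite"
  assumes "\<And>n i. norm (X n $ i) \<le> 1"
  shows "bounded (range X)"
proof -
  have "norm (X n) \<le> (\<Sum>i\<in>(UNIV::'m set). 1)" for n
    using L2_set_le_sum[of UNIV "\<lambda>i. norm (X n $ i)"] sum_mono[of UNIV "\<lambda>i. norm (X n $ i)" "\<lambda>i. 1"] assms
    by (simp add: norm_vec_def)
  then show ?thesis unfolding bounded_iff by blast
qed

lemma mat_vec_scaleR_rows:
  fixes A :: "complex ^ 'n::finite ^ 'm::finite"
  assumes "X $ i = c *\<^sub>R (A $ i)"
  shows "(X *v x) $ i = of_real c * (A *v x) $ i"
proof -
  have "X $ i $ j = of_real c * A $ i $ j" for j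
    by (simp add: assms) (simp add: scaleR_conv_of_real)
  then show ?thesis by (simp add: matrix_vector_mult_def sum_distrib_left mult.assoc)
qed

lemma det_scaleR_rows:
  fixes A X :: "complex ^ 'n::finite ^ 'n"
  assumes "\<And>i. X $ i = c i *\<^sub>R (A $ i)"
  shows "det X = of_real (\<Prod>i\<in>UNIV. c i) * det A"
proof -
  have "X = (\<chi> i. of_real (c i) *s A $ i)" using assms by (simp add: vec_eq_iff) (simp add: scaleR_conv_of_real)
  then show ?thesis by (simp add: det_rows_mul)
qed

lemma row_nonzero:
  fixes A :: "complex ^ 'n::finite ^ 'n"
  assumes "det A = 1"
  shows "A $ i \<noteq> 0"
proof
  assume "A $ i = 0"
  then have "det A = 0" by (intro det_zero_row(1)[of i]) (auto simp: row_def vec_eq_iff)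
  with assms show False by simp
qed

text \<open>Every coordinate occurs exactly once in the monomial, so scaling the rows to length 1
  changes the monomial and the determinant by the same factor. Rows of length 1 have nonzero limits,
  hence so has their product.\<close>

lemma closed_case_monomial:
  fixes A :: "nat \<Rightarrow> complex ^ 5 ^ 5"
  assumes "k \<noteq> 0" and det: "\<And>n. det (A n) = 1"
    and lim: "\<And>x. (\<lambda>n. k * (\<Prod>i\<in>UNIV. (A n *v x) $ i)) \<longlonglongrightarrow> g x"
  shows "\<exists>B. det B = 1 \<and> (\<forall>x. g x = k * (\<Prod>i\<in>UNIV. (B *v x) $ i))"
proof -
  define X where "X n = (\<chi> i. inverse (norm (A n $ i)) *\<^sub>R (A n $ i))" for n
  define t where "t n = (\<Prod>i\<in>UNIV. norm (A n $ i))" for n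
  have pos: "norm (A n $ i) > 0" for n i using row_nonzero[OF det] by simp
  then have t: "t n > 0" for n by (simp add: t_def prod_pos)
  have Xi: "X n $ i = inverse (norm (A n $ i)) *\<^sub>R (A n $ i)" for n i by (simp add: X_def)
  have norm: "norm (X n $ i) = 1" for n i using row_nonzero[OF det] by (simp add: X_def)
  have inv: "(\<Prod>i\<in>UNIV. inverse (norm (A n $ i))) = inverse (t n)" for n
    using prod_inversef[of "\<lambda>i. norm (A n $ i)" UNIV] by (simp add: o_def t_def)
  have "bounded (range X)" by (rule norm_rows_le_1_bounded) (simp add: norm)
  then obtain Y \<sigma> where \<sigma>: "strict_mono \<sigma>" and Y: "(\<lambda>n. X (\<sigma> n)) \<longlonglongrightarrow> Y"
    by (rule bounded_range_subsequence)
  have "norm (Y $ i) = 1" for i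
    using tendsto_norm[OF tendsto_vec_nth[OF Y, of i]] norm by (simp add: LIMSEQ_const_iff)
  then have Yi: "Y $ i \<noteq> 0" for i by (metis norm_zero zero_neq_one)
  obtain z where z: "(\<Prod>i\<in>UNIV. (Y *v z) $ i) \<noteq> 0"
    using all_coords_nonzero[OF Yi] by auto
  have detX: "of_real (t n) * det (X n) = 1" for n
  proof -
    have "det (X n) = of_real (\<Prod>i\<in>UNIV. inverse (norm (A n $ i))) * det (A n)"
      by (rule det_scaleR_rows) (rule Xi)
    then show ?thesis using t[of n] unfolding inv det by simp
  qed
  have formX: "of_real (t n) * (k * (\<Prod>i\<in>UNIV. (X n *v x) $ i)) = k * (\<Prod>i\<in>UNIV. (A n *v x) $ i)" for n x
  proof -
    have "(\<Prod>i\<in>UNIV. (X n *v x) $ i) = (\<Prod>i\<in>UNIV. of_real (inverse (norm (A n $ i))) * (A n *v x) $ i)"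
      by (intro prod.cong refl mat_vec_scaleR_rows Xi)
    also have "\<dots> = of_real (\<Prod>i\<in>UNIV. inverse (norm (A n $ i))) * (\<Prod>i\<in>UNIV. (A n *v x) $ i)"
      by (simp only: prod.distrib of_real_prod)
    finally show ?thesis using t[of n] unfolding inv by simp
  qed
  show ?thesis
  proof (rule rescale_limit[OF Y detX])
    show "(\<lambda>n. of_real (t (\<sigma> n)) * (k * (\<Prod>i\<in>UNIV. (X (\<sigma> n) *v x) $ i))) \<longlonglongrightarrow> g x" for x
      unfolding formX using LIMSEQ_subseq_LIMSEQ[OF lim[of x] \<sigma>] by (simp add: o_def)
    show "continuous_on UNIV (\<lambda>y::complex^5. k * (\<Prod>i\<in>UNIV. y $ i))"
      by (intro continuous_intros)
    show "k * (\<Prod>i\<in>UNIV. (Y *v z) $ i) \<noteq> 0" using z \<open>k \<noteq> 0\<close> by simp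
  qed (simp add: prod_5)
qed

text \<open>Orthonormal bases for a nondegenerate symmetric bilinear form over the complex numbers,
  with one unit vector prescribed. A maximal orthonormal family containing \<open>e\<close> is
  taken; if it were not a basis, maximality would make its orthogonal complement totally isotropic,
  and a nonzero vector there would be orthogonal to the whole space.\<close>

lemma congruence_to_identity:
  fixes S :: "complex ^ 'n::finite ^ 'n" and k :: 'n
  assumes sym: "transpose S = S" and det: "det S \<noteq> 0"
    and e: "(\<Sum>i\<in>UNIV. e $ i * (S *v e) $ i) = 1"
  obtains V where "transpose V ** S ** V = mat 1" "column k V = e"
proof -
  define b where "b x y = (\<Sum>i\<in>UNIV. x $ i * (S *v y) $ i)" for x y
  have b_add: "b x (y + z) = b x y + b x z" "b (y + z) x = b y x + b z x" for x y z
    by (simp_all add: b_def matrix_vector_right_distrib distrib_left distrib_right sum.distrib)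
  have b_scale: "b x (c *s y) = c * b x y" "b (c *s x) y = c * b x y" for x y c
    by (simp_all add: b_def vector_scalar_commute sum_distrib_left mult_ac)
  have b_sym: "b x y = b y x" for x y
  proof -
    have "S $ i $ j = S $ j $ i" for i j using sym by (metis transpose_def vec_lambda_beta)
    then have "(\<Sum>i\<in>UNIV. \<Sum>j\<in>UNIV. x $ i * (S $ i $ j * y $ j))
      = (\<Sum>i\<in>UNIV. \<Sum>j\<in>UNIV. y $ j * (S $ j $ i * x $ i))"
      by (simp add: mult_ac)
    also have "\<dots> = (\<Sum>j\<in>UNIV. \<Sum>i\<in>UNIV. y $ j * (S $ j $ i * x $ i))"
      by (rule sum.swap)
    finally show ?thesis by (simp add: b_def matrix_vector_mult_def sum_distrib_left)
  qed
  have b_sum: "b x (\<Sum>i\<in>I. f i) = (\<Sum>i\<in>I. b x (f i))" if "finite I" for x f and I :: "'n set"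
    using that by induction (simp_all add: b_add, simp add: b_def)
  define good where "good I v \<longleftrightarrow> k \<in> I \<and> v k = e \<and> (\<forall>i\<in>I. \<forall>j\<in>I. b (v i) (v j) = (if i = j then 1 else 0))"
    for I :: "'n set" and v
  have "good {k} (\<lambda>_. e)" using e by (simp add: good_def b_def)
  \<comment> \<open>A family of greatest size exists because sizes are at most
    \<open>CARD('n)\<close>; the bound to be supplied is strict.\<close>
  then have "\<exists>I. (\<exists>v. good I v) \<and> (\<forall>J. (\<exists>v. good J v) \<longrightarrow> card J \<le> card I)"
    by (intro ex_has_greatest_nat[where b = "CARD('n) + 1"]) (auto intro!: le_imp_less_Suc card_mono)
  then obtain I v where good: "good I v" and max: "\<And>J w. good J w \<Longrightarrow> card J \<le> card I"
    by blast
  have "I = UNIV"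
  proof (rule ccontr)
    assume "I \<noteq> UNIV"
    then obtain j where j: "j \<notin> I" by blast
    \<comment> \<open>A vector of the complement with \<open>b w w\<close> nonzero can be normalised
      by a complex square root and would enlarge the family.\<close>
    have no_ext: False if w: "b w w \<noteq> 0" "\<And>i. i \<in> I \<Longrightarrow> b (v i) w = 0" for w
    proof -
      define u where "u = (1 / csqrt (b w w)) *s w"
      have "b u u = 1"
      proof -
        have "csqrt (b w w) * csqrt (b w w) = b w w" by (metis power2_csqrt power2_eq_square)
        then show ?thesis using w(1) by (simp add: u_def b_scale)
      qed
      moreover have "b (v i) u = 0" "b u (v i) = 0" if "i \<in> I" for i
        using w(2)[OF that] b_sym[of u "v i"] by (simp_all add: u_def b_scale)
      ultimately have "good (insert j I) (v(j := u))"
        using good j by (auto simp: good_def)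
      from max[OF this] show False using j by simp
    qed
    \<comment> \<open>Polarisation: x, y and x + y are all isotropic.\<close>
    have iso: "b x y = 0"
      if "\<And>i. i \<in> I \<Longrightarrow> b (v i) x = 0" "\<And>i. i \<in> I \<Longrightarrow> b (v i) y = 0" for x y
    proof -
      have "b x x = 0" "b y y = 0" "b (x + y) (x + y) = 0"
        using no_ext[of x] no_ext[of y] no_ext[of "x + y"] that by (auto simp: b_add)
      then show ?thesis using b_sym[of x y] by (simp add: b_add)
    qed
    \<comment> \<open>The kernel of \<open>W\<close> is the orthogonal complement of the family; the
      zero row \<open>j\<close> makes it nontrivial.\<close>
    define W where "W = (\<chi> i. if i \<in> I then S *v v i else 0)"
    have "W $ j = 0" using j by (simp add: W_def)
    then have "det W = 0" by (intro det_zero_row(1)[of j]) (auto simp: row_def vec_eq_iff)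
    then have "\<not> invertible W" by (simp add: invertible_det_nz)
    then obtain x where x: "x \<noteq> 0" "W *v x = 0"
      by (metis matrix_left_invertible_ker invertible_left_inverse)
    have vx: "b (v i) x = 0" if "i \<in> I" for i
    proof -
      have "0 = (W *v x) $ i" using x by simp
      also have "\<dots> = b x (v i)" using that by (simp add: W_def matrix_vector_mult_def b_def mult.commute)
      finally show ?thesis using b_sym by simp
    qed
    have "b y x = 0" for y
    proof -
      \<comment> \<open>Subtracting the orthogonal projection onto the family moves y into the
        complement without changing its pairing with x.\<close>
      define y' where "y' = y + (\<Sum>i\<in>I. (- b (v i) y) *s v i)"
      have "b x y' = 0"
      proof (rule iso)
        fix i assume i: "i \<in> I"
        have "b (v i) y' = b (v i) y + (\<Sum>l\<in>I. - b (v l) y * b (v i) (v l))"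
          by (simp only: y'_def b_add b_sum b_scale finite)
        also have "(\<Sum>l\<in>I. - b (v l) y * b (v i) (v l)) = (\<Sum>l\<in>I. if i = l then - b (v i) y else 0)"
          using good i by (intro sum.cong) (auto simp: good_def)
        finally show "b (v i) y' = 0" using i by simp
      qed (use vx in auto)
      moreover have "b x y' = b x y + (\<Sum>i\<in>I. - b (v i) y * b x (v i))"
        by (simp only: y'_def b_add b_sum b_scale finite)
      moreover have "(\<Sum>i\<in>I. - b (v i) y * b x (v i)) = 0"
        using vx b_sym[of x] by (intro sum.neutral) simp
      ultimately show ?thesis using b_sym by simp
    qed
    moreover have "b (axis i 1) x = (S *v x) $ i" for i
      by (simp add: b_def axis_def if_distrib[of "\<lambda>y. y * _"] cong: if_cong)
    ultimately have "(S *v x) $ i = 0" for i by metis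
    then have "S *v x = 0" by (simp add: vec_eq_iff)
    with x(1) det show False
      by (metis invertible_det_nz invertible_left_inverse matrix_left_invertible_ker)
  qed
  define V where "V = (\<chi> i j. v j $ i)"
  have "(transpose V ** S ** V) $ i $ j = b (v i) (v j)" for i j
    unfolding b_def V_def matrix_mul_assoc[symmetric]
    by (simp add: matrix_matrix_mult_def transpose_def matrix_vector_mult_def)
  then have "transpose V ** S ** V = mat 1"
    using good \<open>I = UNIV\<close> by (simp add: vec_eq_iff mat_def good_def)
  moreover have "column k V = e" using good by (simp add: V_def good_def column_def vec_eq_iff)
  ultimately show ?thesis using that by blast
qed

subsection \<open>Quadratic forms and their determinants\<close>

text \<open>Complex bilinear, without conjugation, so that \<open>qform\<close> is polynomial in the
  coordinates.\<close>

definition cdot :: "complex ^ 'n::finite \<Rightarrow> complex ^ 'n \<Rightarrow> complex" where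
  "cdot x y = (\<Sum>i\<in>UNIV. x $ i * y $ i)"

definition qform :: "complex ^ 'n::finite ^ 'n \<Rightarrow> complex ^ 'n \<Rightarrow> complex" where
  "qform M x = cdot x (M *v x)"

definition outer :: "complex ^ 'n::finite \<Rightarrow> complex ^ 'n ^ 'n" where
  "outer w = (\<chi> i j. w $ i * w $ j)"

lemma cdot_scaleR: "cdot (r *\<^sub>R w) x = of_real r * cdot w x"
  unfolding cdot_def by (simp add: sum_distrib_left) (simp add: scaleR_conv_of_real)

lemma cdot_add: "cdot (x + y) z = cdot x z + cdot y z" "cdot z (x + y) = cdot z x + cdot z y"
  by (simp_all add: cdot_def distrib_left distrib_right sum.distrib)

lemma cdot_row: "cdot (A $ i) x = (A *v x) $ i"
  by (simp add: cdot_def matrix_vector_mult_def)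

lemma cdot_transpose: "cdot (transpose A *v u) y = cdot u (A *v y)"
proof -
  have "cdot (transpose A *v u) y = (\<Sum>i\<in>UNIV. \<Sum>j\<in>UNIV. A $ j $ i * u $ j * y $ i)"
    unfolding cdot_def matrix_vector_mult_def transpose_def by (simp add: sum_distrib_right)
  also have "\<dots> = (\<Sum>j\<in>UNIV. \<Sum>i\<in>UNIV. A $ j $ i * u $ j * y $ i)" by (rule sum.swap)
  also have "\<dots> = cdot u (A *v y)"
    unfolding cdot_def matrix_vector_mult_def by (simp add: sum_distrib_left mult_ac)
  finally show ?thesis .
qed

lemma cdot_commute: "cdot x y = cdot y x"
  by (simp add: cdot_def mult.commute)

lemma qform_congruence: "qform (transpose A ** M ** A) x = qform M (A *v x)"
  unfolding qform_def cdot_commute[of x] cdot_commute[of "A *v x"]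
  by (simp only: cdot_transpose flip: matrix_vector_mul_assoc)

lemma scaleR_mat_vec: "(r *\<^sub>R M) *v x = of_real r *s (M *v x)"
  for M :: "complex ^ 'n::finite ^ 'm::finite"
proof -
  have "(r *\<^sub>R M) $ i $ j = of_real r * M $ i $ j" for i j
    by simp (simp add: scaleR_conv_of_real)
  then show ?thesis
    by (simp only: vec_eq_iff) (simp add: matrix_vector_mult_def sum_distrib_left mult.assoc)
qed

lemma qform_scaleR: "qform (r *\<^sub>R M) x = of_real r * qform M x"
  unfolding qform_def cdot_def scaleR_mat_vec by (simp add: sum_distrib_left mult_ac)

lemma qform_add: "qform (M + N) x = qform M x + qform N x"
  by (simp add: qform_def cdot_def matrix_vector_mult_add_rdistrib distrib_left sum.distrib)

lemma outer_mat_vec: "outer w *v x = cdot w x *s w"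
  by (simp add: outer_def matrix_vector_mult_def cdot_def vec_eq_iff sum_distrib_left mult_ac)

lemma qform_outer: "qform (outer w) x = (cdot w x)^2"
  by (simp add: qform_def outer_mat_vec) (simp add: cdot_def sum_distrib_left mult_ac power2_eq_square sum_distrib_right)

lemma tendsto_cdot [tendsto_intros]:
  "(u \<longlongrightarrow> u') G \<Longrightarrow> (v \<longlongrightarrow> v') G \<Longrightarrow> ((\<lambda>n. cdot (u n) (v n)) \<longlongrightarrow> cdot u' v') G"
  unfolding cdot_def by (intro tendsto_intros)

lemma tendsto_qform [tendsto_intros]:
  "(M \<longlongrightarrow> M') G \<Longrightarrow> ((\<lambda>n. qform (M n) x) \<longlongrightarrow> qform M' x) G"
  unfolding qform_def by (intro tendsto_intros)

lemma tendsto_outer [tendsto_intros]: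
  "(u \<longlongrightarrow> u') G \<Longrightarrow> ((\<lambda>n. outer (u n)) \<longlongrightarrow> outer u') G"
  unfolding outer_def by (intro vec_tendstoI) (auto intro!: tendsto_intros)

lemma poly_on_lines_cdot: "poly_on_lines (cdot w)"
  unfolding cdot_def poly_on_lines_def
proof (intro allI)
  fix x y
  show "\<exists>p. \<forall>s. (\<Sum>i\<in>UNIV. w $ i * (x + s *s y) $ i) = poly p s"
    by (rule exI[of _ "[: cdot w x, cdot w y :]"])
       (simp add: cdot_def sum_distrib_left distrib_left sum.distrib mult_ac)
qed

lemma poly_on_lines_qform: "poly_on_lines (qform M)"
  unfolding qform_def cdot_def
  by (intro poly_on_lines_sum poly_on_lines_mult poly_on_lines_coord poly_on_lines_mat_vec)

lemma transpose_congruence: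
  fixes A M :: "complex ^ 'n::finite ^ 'n"
  shows "transpose M = M \<Longrightarrow> transpose (transpose A ** M ** A) = transpose A ** M ** A"
  by (simp add: matrix_transpose_mul matrix_mul_assoc)

text \<open>Polarisation: the values at the unit vectors and at their pairwise sums determine the
  entries of a symmetric matrix.\<close>

lemma symmetric_qform_nonzero:
  assumes sym: "transpose M = M" and "M \<noteq> 0"
  obtains x where "qform M x \<noteq> 0"
proof (rule ccontr)
  assume "\<not> thesis"
  then have zero: "qform M x = 0" for x using that by blast
  have M_axis: "(M *v axis j 1) $ i = M $ i $ j" for i j
    by (simp add: matrix_vector_mult_def axis_def if_distrib[of "\<lambda>y. _ * y"] cong: if_cong)
  have cdot_axis: "cdot (axis i 1) y = y $ i" for i y
    by (simp add: cdot_def axis_def if_distrib[of "\<lambda>z. z * _"] cong: if_cong)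
  have "M $ i $ j = 0" for i j
  proof -
    have "M $ i $ i = 0" for i using zero[of "axis i 1"] by (simp add: qform_def cdot_axis M_axis)
    then have "M $ i $ j + M $ j $ i = 0"
      using zero[of "axis i 1 + axis j 1"]
      by (simp add: qform_def cdot_add cdot_axis M_axis matrix_vector_right_distrib add.commute)
    moreover have "M $ j $ i = M $ i $ j" using sym by (metis transpose_def vec_lambda_beta)
    ultimately show ?thesis by simp
  qed
  then have "M = 0" by (simp add: vec_eq_iff)
  with \<open>M \<noteq> 0\<close> show False by simp
qed

text \<open>The square of the linear factor \<open>x$2\<close> as a quadratic form. Added to a
  quadric that does not involve coordinate 2, it lets one determinant keep track of both
  factors.\<close>

abbreviation proj2 :: "complex ^ 5 ^ 5" where
  "proj2 \<equiv> diag (\<lambda>i. if i = 2 then 1 else 0)"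

lemma diag_congruence_nth: "(diag c ** M ** diag c) $ i $ j = c i * c j * M $ i $ j"
proof -
  have "(diag c ** M) $ i $ l = c i * M $ i $ l" for l
    by (simp add: diag_def matrix_matrix_mult_def if_distrib[of "\<lambda>y. y * _"] cong: if_cong)
  moreover have "(N ** diag c) $ i $ j = N $ i $ j * c j" for N
    by (simp add: diag_def matrix_matrix_mult_def if_distrib[of "\<lambda>y. _ * y"] cong: if_cong)
  ultimately show ?thesis by (simp add: mult_ac)
qed

lemma proj2_congruence: "transpose A ** proj2 ** A = outer (A $ 2)"
proof -
  have "(proj2 ** A) $ i $ j = (if i = 2 then A $ i $ j else 0)" for i j
    by (simp add: diag_def matrix_matrix_mult_def if_distrib[of "\<lambda>y. y * _"] cong: if_cong)
  then have "(transpose A ** (proj2 ** A)) $ i $ j = A $ 2 $ i * A $ 2 $ j" for i j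
    by (subst matrix_matrix_mult_def) (simp add: transpose_def if_distrib[of "\<lambda>y. _ * y"] cong: if_cong)
  then show ?thesis by (simp add: vec_eq_iff outer_def matrix_mul_assoc)
qed

lemma outer_scaleR: "outer (r *\<^sub>R w) = r^2 *\<^sub>R outer w"
  by (simp add: outer_def vec_eq_iff power2_eq_square)

text \<open>Normalising the quadric and the linear form amounts to a congruence by a diagonal matrix, because
  Q does not involve coordinate 2.\<close>

lemma det_normalised:
  fixes A Q :: "complex ^ 5 ^ 5"
  assumes Q: "\<And>i. Q $ i $ 2 = 0" "\<And>i. Q $ 2 $ i = 0" and "\<beta> > 0" "L > 0"
  shows "det ((1 / \<beta>) *\<^sub>R (transpose A ** Q ** A) + outer ((1 / L) *\<^sub>R A $ 2)) * of_real (L * \<beta>^2) ^ 2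
    = (det A)^2 * det (Q + proj2)"
proof -
  \<comment> \<open>Four coordinates are divided by the square root of \<open>\<beta>\<close> and
    one by \<open>L\<close>, so the product of the entries is 1 / (L \<beta>^2).\<close>
  define c where "c i = complex_of_real (if i = 2 then 1 / L else 1 / sqrt \<beta>)" for i :: 5
  have "of_real (sqrt \<beta>) * of_real (sqrt \<beta>) = complex_of_real \<beta>"
    using \<open>\<beta> > 0\<close> by (metis abs_of_pos of_real_mult real_sqrt_mult_self)
  then have "(diag c ** (Q + proj2) ** diag c) $ i $ j
      = ((1 / \<beta>) *\<^sub>R Q + (1 / L)^2 *\<^sub>R proj2) $ i $ j" for i j
    unfolding diag_congruence_nth using Q
    by (auto simp: c_def diag_def scaleR_conv_of_real[where 'a = complex] power2_eq_square
        simp del: scaleR_conv_of_real)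
  then have "diag c ** (Q + proj2) ** diag c = (1 / \<beta>) *\<^sub>R Q + (1 / L)^2 *\<^sub>R proj2"
    by (simp only: vec_eq_iff) simp
  moreover have "(M + N) ** A = M ** A + N ** A" for M N :: "complex ^ 5 ^ 5"
    by (simp add: vec_eq_iff matrix_matrix_mult_def distrib_right sum.distrib)
  ultimately have "(1 / \<beta>) *\<^sub>R (transpose A ** Q ** A) + outer ((1 / L) *\<^sub>R A $ 2)
    = transpose A ** (diag c ** (Q + proj2) ** diag c) ** A"
    by (simp only: outer_scaleR flip: proj2_congruence)
       (simp add: matrix_add_ldistrib  matrix_scalar_ac scalar_matrix_assoc)
  then have "det ((1 / \<beta>) *\<^sub>R (transpose A ** Q ** A) + outer ((1 / L) *\<^sub>R A $ 2))
    = (det A)^2 * (prod c UNIV)^2 * det (Q + proj2)"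
    by (simp add: det_mul power2_eq_square mult_ac)
  moreover have "prod c UNIV * of_real (L * \<beta>^2) = 1"
  proof -
    have "sqrt \<beta> * sqrt \<beta> = \<beta>" using \<open>\<beta> > 0\<close> by simp
    then have "(\<Prod>i\<in>(UNIV::5 set). (if i = 2 then 1 / L else 1 / sqrt \<beta> :: real)) = (1 / \<beta>) * (1 / \<beta>) * (1 / L)"
      unfolding prod_5 using assms(3,4) by (simp add: field_simps)
    then have "(\<Prod>i\<in>(UNIV::5 set). (if i = 2 then 1 / L else 1 / sqrt \<beta> :: real)) * (L * \<beta>^2) = 1"
      using assms(3,4) by (simp add: power2_eq_square)
    then show ?thesis unfolding c_def of_real_prod[symmetric] of_real_mult[symmetric] by simp
  qed
  ultimately show ?thesis by (simp add: power_mult_distrib[symmetric] mult_ac)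
qed

section \<open>Closedness when the two quadrics coincide\<close>

lemma bounded_norm_1: "(\<And>n. norm (X n) = 1) \<Longrightarrow> bounded (range X)"
  unfolding bounded_iff by (auto intro!: exI[of _ 1])

lemma congruence_nonzero:
  fixes A Q :: "complex ^ 'n::finite ^ 'n"
  assumes "det A \<noteq> 0" "qform Q y \<noteq> 0"
  shows "transpose A ** Q ** A \<noteq> 0"
proof
  assume 0: "transpose A ** Q ** A = 0"
  obtain B where "A ** B = mat 1" using assms(1) invertible_det_nz[of A] unfolding invertible_def by blast
  then have "qform Q y = qform Q (A *v (B *v y))" by (simp add: matrix_vector_mul_assoc)
  also have "\<dots> = qform 0 (B *v y)" using 0 by (simp flip: qform_congruence)
  finally show False using assms(2) by (simp add: qform_def cdot_def)
qed

text \<open>The matrices may diverge even after rescaling, since the complex orthogonal group of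
  \<open>q\<close> is not compact. Instead the pulled back quadric and linear form are normalised
  and made to converge, and a new matrix is built from the two limits.\<close>

lemma closed_case_square:
  fixes A :: "nat \<Rightarrow> complex ^ 5 ^ 5"
  defines "q \<equiv> \<lambda>y::complex^5. (y$0)^2 + (y$1)^2 + (y$3)^2 + (y$4)^2"
  assumes "k \<noteq> 0" and det: "\<And>n. det (A n) = 1"
    and lim: "\<And>x. (\<lambda>n. k * ((A n *v x) $ 2 * (q (A n *v x))^2)) \<longlonglongrightarrow> g x"
  shows "\<exists>B. det B = 1 \<and> (\<forall>x. g x = k * ((B *v x) $ 2 * (q (B *v x))^2))"
proof -
  define Q where "Q = diag (\<lambda>i::5. if i = 2 then 0 else 1)"
  have qform_Q: "qform Q y = q y" for y
    by (simp add: qform_def cdot_def Q_def q_def sum_5 power2_eq_square)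
  have Q0: "Q $ i $ 2 = 0" "Q $ 2 $ i = 0" for i by (simp_all add: Q_def diag_def)
  have Q_proj2: "Q + proj2 = mat 1" by (simp add: Q_def diag_def mat_def vec_eq_iff)
  have sym_Q: "transpose Q = Q" by (simp add: Q_def diag_def transpose_def vec_eq_iff)
  define K where "K n = transpose (A n) ** Q ** A n" for n
  have K_nz: "K n \<noteq> 0" for n
    unfolding K_def
    by (rule congruence_nonzero[where y = "axis 0 1"]) (simp_all add: det qform_Q q_def axis_def)
  define \<beta> where "\<beta> n = norm (K n)" for n
  define L where "L n = norm (A n $ 2)" for n
  have pos: "\<beta> n > 0" "L n > 0" for n
    using K_nz row_nonzero[OF det] by (simp_all add: \<beta>_def L_def)
  define N where "N n = (1 / \<beta> n) *\<^sub>R K n" for n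
  define \<alpha> where "\<alpha> n = (1 / L n) *\<^sub>R A n $ 2" for n
  have norms: "norm (N n) = 1" "norm (\<alpha> n) = 1" for n
    using pos[of n] by (simp_all add: N_def \<alpha>_def) (simp_all add: \<beta>_def L_def)
  obtain N' \<sigma>1 where \<sigma>1: "strict_mono \<sigma>1" and N'1: "(\<lambda>n. N (\<sigma>1 n)) \<longlonglongrightarrow> N'"
    by (rule bounded_range_subsequence[OF bounded_norm_1]) (rule norms)
  obtain w \<sigma>2 where \<sigma>2: "strict_mono \<sigma>2" and w: "(\<lambda>n. \<alpha> (\<sigma>1 (\<sigma>2 n))) \<longlonglongrightarrow> w"
    by (rule bounded_range_subsequence[OF bounded_norm_1[of "\<lambda>n. \<alpha> (\<sigma>1 n)"]]) (rule norms)
  define \<sigma> where "\<sigma> n = \<sigma>1 (\<sigma>2 n)" for n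
  have \<sigma>: "strict_mono \<sigma>" using \<sigma>1 \<sigma>2 unfolding \<sigma>_def strict_mono_def by blast
  have N': "(\<lambda>n. N (\<sigma> n)) \<longlonglongrightarrow> N'"
    using LIMSEQ_subseq_LIMSEQ[OF N'1 \<sigma>2] by (simp add: o_def \<sigma>_def)
  have w: "(\<lambda>n. \<alpha> (\<sigma> n)) \<longlonglongrightarrow> w" using w by (simp add: \<sigma>_def)
  have "norm N' = 1" "norm w = 1"
    using tendsto_norm[OF N'] tendsto_norm[OF w] norms by (simp_all add: LIMSEQ_const_iff)
  then have nz: "N' \<noteq> 0" "w \<noteq> 0" by auto
  have "transpose (N n) = N n" for n
    using transpose_congruence[OF sym_Q, of "A n"] by (simp add: N_def K_def transpose_scalar)
  then have "(\<lambda>n. N (\<sigma> n)) \<longlonglongrightarrow> transpose N'" using tendsto_transpose[OF N'] by simp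
  then have sym: "transpose N' = N'" using N' by (rule LIMSEQ_unique)
  define t where "t n = complex_of_real (L n * (\<beta> n)^2)" for n
  have form: "k * ((A n *v x) $ 2 * (q (A n *v x))^2)
      = t n * (k * (cdot (\<alpha> n) x * (qform (N n) x)^2))" for n x
  proof -
    have "complex_of_real (L n) * cdot (\<alpha> n) x = (A n *v x) $ 2"
      using pos[of n] by (simp add: \<alpha>_def cdot_scaleR cdot_row)
    moreover have "complex_of_real (\<beta> n) * qform (N n) x = q (A n *v x)"
      using pos[of n] by (simp add: N_def qform_scaleR K_def qform_congruence qform_Q)
    ultimately have "k * ((A n *v x) $ 2 * (q (A n *v x))^2) =
      k * ((complex_of_real (L n) * cdot (\<alpha> n) x) * (complex_of_real (\<beta> n) * qform (N n) x)^2)"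
      by simp
    then show ?thesis by (simp only: t_def of_real_mult of_real_power power_mult_distrib mult_ac)
  qed
  obtain j where "w $ j \<noteq> 0" using nz(2) by (auto simp: vec_eq_iff)
  then have "cdot w (axis j 1) \<noteq> 0"
    by (simp add: cdot_def axis_def if_distrib[of "\<lambda>z. _ * z"] cong: if_cong)
  moreover obtain y where "qform N' y \<noteq> 0" by (rule symmetric_qform_nonzero[OF sym nz(1)])
  ultimately obtain z where z: "cdot w z \<noteq> 0" "qform N' z \<noteq> 0"
    by (rule poly_on_lines_mult_nonzero[OF poly_on_lines_cdot poly_on_lines_qform])
  define h where "h x = k * (cdot w x * (qform N' x)^2)" for x
  have lim_h: "(\<lambda>n. k * (cdot (\<alpha> (\<sigma> n)) x * (qform (N (\<sigma> n)) x)^2)) \<longlonglongrightarrow> h x" for x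
    unfolding h_def by (intro tendsto_intros N' w)
  have lim_t: "(\<lambda>n. t (\<sigma> n) * (k * (cdot (\<alpha> (\<sigma> n)) x * (qform (N (\<sigma> n)) x)^2))) \<longlonglongrightarrow> g x" for x
    using LIMSEQ_subseq_LIMSEQ[OF lim[of x] \<sigma>] by (simp add: o_def form)
  have hz: "h z \<noteq> 0" using z \<open>k \<noteq> 0\<close> by (simp add: h_def)
  define \<tau> where "\<tau> = g z / h z"
  have t: "(\<lambda>n. t (\<sigma> n)) \<longlonglongrightarrow> \<tau>"
  proof (rule Lim_transform_eventually)
    show "(\<lambda>n. (t (\<sigma> n) * (k * (cdot (\<alpha> (\<sigma> n)) z * (qform (N (\<sigma> n)) z)^2)))
        / (k * (cdot (\<alpha> (\<sigma> n)) z * (qform (N (\<sigma> n)) z)^2))) \<longlonglongrightarrow> \<tau>"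
      unfolding \<tau>_def by (intro tendsto_divide lim_t lim_h hz)
    show "eventually (\<lambda>n. (t (\<sigma> n) * (k * (cdot (\<alpha> (\<sigma> n)) z * (qform (N (\<sigma> n)) z)^2)))
        / (k * (cdot (\<alpha> (\<sigma> n)) z * (qform (N (\<sigma> n)) z)^2)) = t (\<sigma> n)) sequentially"
      using tendsto_imp_eventually_ne[OF lim_h hz] by (rule eventually_mono) simp
  qed
  have g: "g x = \<tau> * h x" for x
    using lim_t[of x] tendsto_mult[OF t lim_h[of x]] by (rule LIMSEQ_unique)

  \<comment> \<open>As \<open>Q + proj2\<close> is the identity, the determinant of the normalised
    sum times \<open>(t n)^2\<close> is always 1. This survives in the limit and makes
    \<open>S\<close> nondegenerate.\<close>
  define S where "S = N' + outer w"
  have "det (N n + outer (\<alpha> n)) * (t n)^2 = 1" for n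
    using det_normalised[OF Q0 pos(1)[of n] pos(2)[of n], of "A n"]
    by (simp add: N_def \<alpha>_def K_def t_def det Q_proj2)
  moreover have "(\<lambda>n. det (N (\<sigma> n) + outer (\<alpha> (\<sigma> n))) * (t (\<sigma> n))^2) \<longlonglongrightarrow> det S * \<tau>^2"
    unfolding S_def by (intro tendsto_intros N' w t)
  ultimately have det_S: "det S * \<tau>^2 = 1" by (simp add: LIMSEQ_const_iff)
  have sym_S: "transpose S = S"
  proof -
    have "N' $ i $ j = transpose N' $ j $ i" for i j by (simp add: transpose_def)
    then have "N' $ i $ j = N' $ j $ i" for i j unfolding sym .
    then show ?thesis by (simp add: S_def outer_def transpose_def vec_eq_iff mult.commute)
  qed
  \<comment> \<open>Row 2 of \<open>Q\<close> is zero, so the quadrics are degenerate and so is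
    their limit. On a kernel vector of \<open>N'\<close> the matrix \<open>S\<close> acts through
    \<open>w\<close> alone.\<close>
  have "det (N n) = 0" for n
  proof -
    have "N n = transpose (A n) ** ((1 / \<beta> n) *\<^sub>R Q) ** A n"
      by (simp add: N_def K_def matrix_scalar_ac scalar_matrix_assoc)
    moreover have "((1 / \<beta> n) *\<^sub>R Q) $ 2 = 0" by (simp add: vec_eq_iff Q0)
    then have "det ((1 / \<beta> n) *\<^sub>R Q) = 0"
      by (intro det_zero_row(1)[of 2]) (auto simp: row_def vec_eq_iff)
    ultimately show ?thesis by (simp add: det_mul)
  qed
  then have "det N' = 0" using tendsto_det[OF N'] by (simp add: LIMSEQ_const_iff)
  then have "\<not> (\<exists>B. B ** N' = mat 1)" by (metis det_I det_mul mult_zero_right zero_neq_one)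
  then obtain e where e: "N' *v e = 0" "e \<noteq> 0" unfolding matrix_left_invertible_ker by blast
  have Se: "S *v e = cdot w e *s w"
    by (simp add: S_def matrix_vector_mult_add_rdistrib e outer_mat_vec)
  have det_S_nz: "det S \<noteq> 0" using det_S by auto
  then obtain S' where "S' ** S = mat 1" using invertible_det_nz[of S] unfolding invertible_def by blast
  then have "S *v e \<noteq> 0" using e(2) matrix_left_invertible_ker[of S] by blast
  then have we: "cdot w e \<noteq> 0" using Se by auto
  \<comment> \<open>With this scaling \<open>S\<close> maps \<open>e'\<close> to \<open>w\<close>,
    so \<open>e'\<close> is a unit vector for \<open>S\<close> and pairing with it is the linear
    form \<open>w\<close>. Prescribing it as column 2 turns \<open>w\<close> into coordinate
    2.\<close>
  define e' where "e' = (1 / cdot w e) *s e"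
  have Se': "S *v e' = w" using we by (simp add: e'_def vector_scalar_commute Se)
  have "cdot w e' = 1" using we by (simp add: e'_def cdot_def sum_distrib_left[symmetric] mult_ac sum_divide_distrib[symmetric])
  then have "(\<Sum>i\<in>UNIV. e' $ i * (S *v e') $ i) = 1"
    unfolding Se' cdot_def by (simp add: mult.commute)
  then obtain V :: "complex ^ 5 ^ 5" where V: "transpose V ** S ** V = mat 1" "column 2 V = e'"
    by (rule congruence_to_identity[OF sym_S det_S_nz, where k = 2])
  have "V *v axis 2 1 = e'"
    using V(2) by (simp add: column_def matrix_vector_mult_def axis_def vec_eq_iff
        if_distrib[of "\<lambda>y. _ * y"] cong: if_cong)
  then have "transpose V *v w = (transpose V ** S ** V) *v axis 2 1"
    by (simp only: flip: Se' matrix_vector_mul_assoc)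
  then have "transpose V *v w = axis 2 1" by (simp only: V(1) matrix_vector_mul_lid)
  then have wV: "cdot w (V *v y) = y $ 2" for y
    using cdot_transpose[of V w y]
    by (simp only:) (simp add: cdot_def axis_def if_distrib[of "\<lambda>z. z * _"] cong: if_cong)
  \<comment> \<open>In the new coordinates \<open>S\<close> is the sum of five squares, and the
    square of \<open>w\<close> is one of them; removing it leaves \<open>q\<close>.\<close>
  have NV: "qform N' (V *v y) = q y" for y
  proof -
    have "qform S (V *v y) = qform (mat 1) y" by (simp only: qform_congruence flip: V(1))
    also have "\<dots> = q y + (y $ 2)^2"
      by (simp add: qform_def cdot_def q_def sum_5 power2_eq_square)
    finally show ?thesis by (simp add: S_def qform_add qform_outer wV)
  qed
  have "det (transpose V ** S ** V) = 1" using V(1) by simp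
  then have det_V: "det V * det S * det V = 1" by (simp add: det_mul)
  then have V_nz: "det V \<noteq> 0" by auto
  then obtain U where U: "V ** U = mat 1" using invertible_det_nz[of V] unfolding invertible_def by blast
  have det_U: "det V * det U = 1" using U by (metis det_I det_mul)
  have VU: "V *v (U *v x) = x" for x using U by (simp add: matrix_vector_mul_assoc)
  \<comment> \<open>Comparing the two determinant identities gives det V = \<open>\<tau>\<close> up
    to sign. The sign is absorbed by coordinate 0, where \<open>q\<close> does not see it, and
    \<open>\<tau>\<close> by the linear factor.\<close>
  define \<epsilon> where "\<epsilon> = det V / \<tau>"
  have "\<tau> \<noteq> 0" using det_S by auto
  have "\<epsilon>^2 = 1"
  proof -
    have "(det V)^2 * det S = \<tau>^2 * det S"
      using det_V det_S by (simp add: power2_eq_square mult_ac)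
    then have "(det V)^2 = \<tau>^2" using det_S_nz by simp
    then show ?thesis using \<open>\<tau> \<noteq> 0\<close> by (simp add: \<epsilon>_def power_divide)
  qed
  define B where "B = diag (\<lambda>i. if i = 0 then \<epsilon> else if i = 2 then \<tau> else 1) ** U"
  have "det B = \<epsilon> * \<tau> * det U" by (simp add: B_def det_mul prod_5)
  then have "det B = 1" using det_U \<open>\<tau> \<noteq> 0\<close> by (simp add: \<epsilon>_def)
  moreover have "g x = k * ((B *v x) $ 2 * (q (B *v x))^2)" for x
  proof -
    have "g x = \<tau> * (k * ((U *v x) $ 2 * (q (U *v x))^2))"
      using g[of x] wV[of "U *v x"] NV[of "U *v x"] by (simp add: h_def VU)
    moreover have "(B *v x) $ 2 = \<tau> * (U *v x) $ 2"
      by (simp add: B_def flip: matrix_vector_mul_assoc)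
    moreover have "q (B *v x) = q (U *v x)"
      using \<open>\<epsilon>^2 = 1\<close> by (simp add: B_def q_def power_mult_distrib flip: matrix_vector_mul_assoc)
    ultimately show ?thesis by simp
  qed
  ultimately show ?thesis by blast
qed

subsection \<open>Products of a linear form and two quadrics\<close>

text \<open>The factor u - r v.\<close>

definition split_quadric :: "complex \<Rightarrow> complex ^ 5 \<Rightarrow> complex" where
  "split_quadric r y = y$0 * y$4 - r * (y$1 * y$3)"

definition split_quadric_matrix :: "complex \<Rightarrow> complex ^ 5 ^ 5" where
  "split_quadric_matrix r = (\<chi> i j. if i = 0 \<and> j = 4 \<or> i = 4 \<and> j = 0 then 1 / 2
    else if i = 1 \<and> j = 3 \<or> i = 3 \<and> j = 1 then - r / 2 else 0)"

lemma qform_split_quadric_matrix: "qform (split_quadric_matrix r) = split_quadric r"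
  by (simp add: fun_eq_iff qform_def cdot_def matrix_vector_mult_def sum_5 split_quadric_matrix_def
      split_quadric_def field_simps)

lemma split_quadric_matrix_nondegenerate:
  assumes "r \<noteq> 0"
  shows "det (split_quadric_matrix r + proj2) \<noteq> 0"
proof -
  have "x = 0" if "(split_quadric_matrix r + proj2) *v x = 0" for x
  proof -
    have "\<forall>i. ((split_quadric_matrix r + proj2) *v x) $ i = 0" using that by simp
    then show ?thesis using assms
      by (simp add: forall_5 matrix_vector_mult_def sum_5 split_quadric_matrix_def diag_def vec_eq_iff)
  qed
  then have "\<exists>B. B ** (split_quadric_matrix r + proj2) = mat 1"
    unfolding matrix_left_invertible_ker by blast
  then show ?thesis by (metis det_I det_mul mult_zero_right zero_neq_one)
qed

lemma poly_on_lines_split_quadric: "poly_on_lines (\<lambda>x. split_quadric r (A *v x))"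
  unfolding qform_split_quadric_matrix[symmetric] qform_congruence[symmetric]
  by (rule poly_on_lines_qform)

lemma tendsto_split_quadric [tendsto_intros]:
  "(y \<longlongrightarrow> z) G \<Longrightarrow> ((\<lambda>n. split_quadric r (y n)) \<longlongrightarrow> split_quadric r z) G"
  unfolding split_quadric_def by (intro tendsto_intros)

text \<open>If the quadric with parameter r tended to zero, convergence of the product would bound
  t times its norm, so t times the square of its norm would tend to zero. The determinant
  of the quadric plus the square of the linear factor excludes that.\<close>

lemma split_quadric_limit_nonzero:
  fixes X :: "nat \<Rightarrow> complex ^ 5 ^ 5"
  assumes X: "X \<longlonglongrightarrow> Y" and det: "\<And>n. of_real (t n) * det (X n) = 1" and "k \<noteq> 0" "r \<noteq> 0"
    and lim: "\<And>x. (\<lambda>n. of_real (t n) * (k * ((X n *v x) $ 2 * split_quadric r (X n *v x)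
      * split_quadric s (X n *v x)))) \<longlonglongrightarrow> g x"
    and Y2: "Y $ 2 \<noteq> 0" and s: "split_quadric s (Y *v xs) \<noteq> 0"
  shows "\<exists>x. split_quadric r (Y *v x) \<noteq> 0"
proof (rule ccontr)
  assume zero: "\<not> ?thesis"
  define Q where "Q = split_quadric_matrix r"
  have sym_Q: "transpose Q = Q"
    by (simp add: Q_def split_quadric_matrix_def transpose_def vec_eq_iff forall_5)
  have Q0: "Q $ i $ 2 = 0" "Q $ 2 $ i = 0" for i by (simp_all add: Q_def split_quadric_matrix_def)
  define K where "K n = transpose (X n) ** Q ** X n" for n
  have K_lim: "K \<longlonglongrightarrow> transpose Y ** Q ** Y"
    unfolding K_def by (intro tendsto_intros X)
  have K_form: "qform (K n) x = split_quadric r (X n *v x)" for n x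
    by (simp add: K_def qform_congruence Q_def qform_split_quadric_matrix)
  have "transpose Y ** Q ** Y = 0"
  proof (rule ccontr)
    assume "transpose Y ** Q ** Y \<noteq> 0"
    then obtain x where "qform (transpose Y ** Q ** Y) x \<noteq> 0"
      by (rule symmetric_qform_nonzero[OF transpose_congruence[OF sym_Q]])
    then show False using zero by (simp add: qform_congruence Q_def qform_split_quadric_matrix)
  qed
  with K_lim have K_lim: "(\<lambda>n. norm (K n)) \<longlonglongrightarrow> 0" using tendsto_norm_zero by metis
  have det_nz: "det (X n) \<noteq> 0" for n using det[of n] by auto
  have "K n \<noteq> 0" for n
    unfolding K_def
    by (rule congruence_nonzero[where y = "axis 0 1 + axis 4 1"])
       (simp_all add: det_nz Q_def qform_split_quadric_matrix split_quadric_def axis_def)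
  then have pos: "norm (K n) > 0" for n by simp
  \<comment> \<open>The matrices \<open>K n\<close> tend to 0, but their directions still have a
    nonzero limit along a subsequence.\<close>
  define N where "N n = (1 / norm (K n)) *\<^sub>R K n" for n
  have norm_N: "norm (N n) = 1" for n using pos[of n] by (simp add: N_def)
  obtain N' \<sigma> where \<sigma>: "strict_mono \<sigma>" and N': "(\<lambda>n. N (\<sigma> n)) \<longlonglongrightarrow> N'"
    by (rule bounded_range_subsequence[OF bounded_norm_1]) (rule norm_N)
  have "norm N' = 1" using tendsto_norm[OF N'] norm_N by (simp add: LIMSEQ_const_iff)
  then have N'_nz: "N' \<noteq> 0" by auto
  have "transpose (N n) = N n" for n
    using transpose_congruence[OF sym_Q, of "X n"] by (simp add: N_def K_def transpose_scalar)
  then have "(\<lambda>n. N (\<sigma> n)) \<longlonglongrightarrow> transpose N'" using tendsto_transpose[OF N'] by simp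
  then have sym: "transpose N' = N'" using N' by (rule LIMSEQ_unique)
  have X\<sigma>: "(\<lambda>n. X (\<sigma> n)) \<longlonglongrightarrow> Y" using LIMSEQ_subseq_LIMSEQ[OF X \<sigma>] by (simp add: o_def)
  have K\<sigma>: "(\<lambda>n. norm (K (\<sigma> n))) \<longlonglongrightarrow> 0"
    using LIMSEQ_subseq_LIMSEQ[OF K_lim \<sigma>] by (simp add: o_def)

  obtain x2 where x2: "(Y *v x2) $ 2 \<noteq> 0" by (rule mat_vec_row_nonzero[OF Y2])
  obtain xr where xr: "qform N' xr \<noteq> 0" by (rule symmetric_qform_nonzero[OF sym N'_nz])
  obtain y where y: "(Y *v y) $ 2 \<noteq> 0" "qform N' y \<noteq> 0"
    by (rule poly_on_lines_mult_nonzero[OF poly_on_lines_mat_vec poly_on_lines_qform x2 xr])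
  then have "(Y *v y) $ 2 * qform N' y \<noteq> 0" by simp
  from poly_on_lines_mult_nonzero[OF poly_on_lines_mult[OF poly_on_lines_mat_vec poly_on_lines_qform]
      poly_on_lines_split_quadric this s]
  obtain z where z: "(Y *v z) $ 2 * qform N' z \<noteq> 0" "split_quadric s (Y *v z) \<noteq> 0" by blast
  define h where "h n = k * ((X n *v z) $ 2 * qform (N n) z * split_quadric s (X n *v z))" for n
  define h' where "h' = k * ((Y *v z) $ 2 * qform N' z * split_quadric s (Y *v z))"
  have h: "(\<lambda>n. h (\<sigma> n)) \<longlonglongrightarrow> h'"
    unfolding h_def h'_def by (intro tendsto_intros N' X\<sigma>)
  have h'_nz: "h' \<noteq> 0" using z \<open>k \<noteq> 0\<close> by (simp add: h'_def)
  \<comment> \<open>The scalar left after replacing \<open>K n\<close> by its direction. It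
    converges because \<open>h\<close> has a nonzero limit, so its product with the norm of
    \<open>K n\<close> tends to 0.\<close>
  define u where "u n = complex_of_real (t n * norm (K n))" for n
  have uh: "of_real (t n) * (k * ((X n *v z) $ 2 * split_quadric r (X n *v z)
      * split_quadric s (X n *v z))) = u n * h n" for n
  proof -
    have "qform (N n) z = split_quadric r (X n *v z) / of_real (norm (K n))"
      by (simp add: N_def qform_scaleR K_form)
    then show ?thesis using pos[of n] by (simp add: u_def h_def)
  qed
  have "(\<lambda>n. u (\<sigma> n) * h (\<sigma> n)) \<longlonglongrightarrow> g z"
    using LIMSEQ_subseq_LIMSEQ[OF lim[of z] \<sigma>] by (simp only: o_def uh)
  then have "(\<lambda>n. u (\<sigma> n) * h (\<sigma> n) / h (\<sigma> n)) \<longlonglongrightarrow> g z / h'"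
    by (intro tendsto_divide h h'_nz)
  moreover have "eventually (\<lambda>n. u (\<sigma> n) * h (\<sigma> n) / h (\<sigma> n) = u (\<sigma> n)) sequentially"
    using tendsto_imp_eventually_ne[OF h h'_nz] by (rule eventually_mono) simp
  ultimately have "(\<lambda>n. u (\<sigma> n)) \<longlonglongrightarrow> g z / h'" by (rule Lim_transform_eventually)
  from tendsto_mult[OF this tendsto_of_real[OF K\<sigma>]]
  have "(\<lambda>n. u (\<sigma> n) * complex_of_real (norm (K (\<sigma> n)))) \<longlonglongrightarrow> 0" by simp
  moreover have "(\<lambda>n. N (\<sigma> n) + outer (X (\<sigma> n) $ 2)) \<longlonglongrightarrow> N' + outer (Y $ 2)"
    by (intro tendsto_intros N' X\<sigma>)
  ultimately have "(\<lambda>n. det (N (\<sigma> n) + outer (X (\<sigma> n) $ 2)) * (u (\<sigma> n) * complex_of_real (norm (K (\<sigma> n))))^2)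
      \<longlonglongrightarrow> det (N' + outer (Y $ 2)) * 0^2"
    by (intro tendsto_mult tendsto_power tendsto_det)
  moreover have "det (N n + outer (X n $ 2)) * (u n * complex_of_real (norm (K n)))^2 = det (Q + proj2)" for n
  proof -
    have "det (N n + outer (X n $ 2)) * of_real ((norm (K n))^2)^2 = (det (X n))^2 * det (Q + proj2)"
      \<comment> \<open>Only the quadric is normalised here: the linear form keeps its length, that
        is, L = 1.\<close>
      using det_normalised[OF Q0 pos[of n] zero_less_one, of "X n"] by (simp add: N_def K_def)
    then have "of_real (t n)^2 * (det (N n + outer (X n $ 2)) * of_real ((norm (K n))^2)^2)
      = (of_real (t n) * det (X n))^2 * det (Q + proj2)"
      by (simp add: power_mult_distrib mult_ac)
    then show ?thesis unfolding det by (simp add: u_def power_mult_distrib power2_eq_square mult_ac)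
  qed
  ultimately have "det (Q + proj2) = 0" by (simp add: LIMSEQ_const_iff)
  with split_quadric_matrix_nondegenerate[OF \<open>r \<noteq> 0\<close>] show False by (simp add: Q_def)
qed

text \<open>Rows 0 and 4 can be scaled against each other without changing u, and likewise rows 1
  and 3 for v. Balancing each pair and dividing u and v by the same number keeps the matrices
  bounded and both quadrics intact up to a scalar.\<close>

lemma closed_case_split:
  fixes A :: "nat \<Rightarrow> complex ^ 5 ^ 5"
  assumes "k \<noteq> 0" "r \<noteq> 0" "s \<noteq> 0" "r \<noteq> s" and det: "\<And>n. det (A n) = 1"
    and lim: "\<And>x. (\<lambda>n. k * ((A n *v x) $ 2 * split_quadric r (A n *v x)
      * split_quadric s (A n *v x))) \<longlonglongrightarrow> g x"
  shows "\<exists>B. det B = 1 \<and> (\<forall>x. g x = k * ((B *v x) $ 2 * split_quadric r (B *v x)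
      * split_quadric s (B *v x)))"
proof -
  define p where "p y = k * (y $ 2 * split_quadric r y * split_quadric s y)" for y
  define a where "a n i = norm (A n $ i)" for n i
  define U where "U n = a n 0 * a n 4" for n
  define V where "V n = a n 1 * a n 3" for n
  define m where "m n = max (U n) (V n)" for n
  have a: "a n i > 0" for n i using row_nonzero[OF det] by (simp add: a_def)
  then have UV: "U n > 0" "V n > 0" for n by (simp_all add: U_def V_def)
  then have m: "m n > 0" for n by (simp add: m_def less_max_iff_disj)
  \<comment> \<open>After scaling, both rows of a pair have equal length at most 1, and the factors
    within each pair multiply to 1 / m.\<close>
  define c where "c n i = (if i = 2 then 1 else if i = 0 \<or> i = 4 then sqrt (U n / m n) else sqrt (V n / m n)) / a n i"
    for n and i :: 5
  define X where "X n = (\<chi> i. c n i *\<^sub>R (A n $ i))" for n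
  have Xi: "X n $ i = c n i *\<^sub>R (A n $ i)" for n i by (simp add: X_def)
  have norm_X: "norm (X n $ i) = (if i = 2 then 1 else if i = 0 \<or> i = 4 then sqrt (U n / m n) else sqrt (V n / m n))"
    for n i
    using a[of n i] UV[of n] m[of n] by (simp add: Xi c_def a_def)
  have "U n / m n \<le> 1" "V n / m n \<le> 1" for n using m[of n] by (simp_all add: m_def)
  then have "norm (X n $ i) \<le> 1" for n i by (simp add: norm_X)
  then have "bounded (range X)" by (rule norm_rows_le_1_bounded)
  then obtain Y \<sigma> where \<sigma>: "strict_mono \<sigma>" and Y: "(\<lambda>n. X (\<sigma> n)) \<longlonglongrightarrow> Y"
    by (rule bounded_range_subsequence)
  define t where "t n = a n 2 * (m n)^2" for n
  have cc: "c n 0 * c n 4 = 1 / m n" "c n 1 * c n 3 = 1 / m n" "c n 2 = 1 / a n 2" for n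
  proof -
    have "sqrt (U n / m n) * sqrt (U n / m n) = U n / m n" "sqrt (V n / m n) * sqrt (V n / m n) = V n / m n"
      using UV[of n] m[of n] by simp_all
    moreover have "c n 0 * c n 4 = sqrt (U n / m n) * sqrt (U n / m n) / U n"
      "c n 1 * c n 3 = sqrt (V n / m n) * sqrt (V n / m n) / V n"
      by (simp_all only: c_def U_def V_def times_divide_times_eq) simp_all
    ultimately show "c n 0 * c n 4 = 1 / m n" "c n 1 * c n 3 = 1 / m n"
      using UV[of n] by simp_all
  qed (simp add: c_def)
  have det_X: "of_real (t n) * det (X n) = 1" for n
  proof -
    have "det (X n) = of_real (\<Prod>i\<in>UNIV. c n i) * det (A n)"
      by (rule det_scaleR_rows) (rule Xi)
    also have "(\<Prod>i\<in>UNIV. c n i) = (c n 0 * c n 4) * (c n 1 * c n 3) * c n 2"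
      by (simp add: prod_5)
    also have "\<dots> = 1 / t n" unfolding cc by (simp add: t_def power2_eq_square)
    finally show ?thesis using a[of n 2] m[of n] by (simp add: det t_def)
  qed
  have XA: "(X n *v x) $ i = of_real (c n i) * (A n *v x) $ i" for n x i
    by (rule mat_vec_scaleR_rows) (rule Xi)
  have quadric: "split_quadric r (X n *v x) = split_quadric r (A n *v x) / of_real (m n)" for n x r
  proof -
    have "split_quadric r (X n *v x) = of_real (c n 0 * c n 4) * ((A n *v x) $ 0 * (A n *v x) $ 4)
        - r * (of_real (c n 1 * c n 3) * ((A n *v x) $ 1 * (A n *v x) $ 3))"
      by (simp add: split_quadric_def XA mult_ac)
    then show ?thesis unfolding cc by (simp add: split_quadric_def field_simps diff_divide_distrib)
  qed
  have form: "of_real (t n) * p (X n *v x) = p (A n *v x)" for n x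
    using a[of n 2] m[of n]
    by (simp add: p_def quadric XA cc t_def power2_eq_square)
  have lim_t: "(\<lambda>n. of_real (t (\<sigma> n)) * p (X (\<sigma> n) *v x)) \<longlonglongrightarrow> g x" for x
    unfolding form using LIMSEQ_subseq_LIMSEQ[OF lim[of x] \<sigma>] by (simp add: o_def p_def)
  have norm_lim: "(\<lambda>n. norm (X (\<sigma> n) $ i)) \<longlonglongrightarrow> norm (Y $ i)" for i
    by (intro tendsto_intros Y)
  have "norm (Y $ 2) = 1" using norm_lim[of 2] by (simp add: norm_X LIMSEQ_const_iff)
  then have Y2: "Y $ 2 \<noteq> 0" by auto
  \<comment> \<open>The larger of u and v was normalised to 1, so in the limit at least one pair
    consists of two nonzero rows.\<close>
  have "max (norm (X n $ 0) * norm (X n $ 4)) (norm (X n $ 1) * norm (X n $ 3)) = 1" for n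
    using UV[of n] by (auto simp: norm_X m_def max_def)
  moreover have "(\<lambda>n. max (norm (X (\<sigma> n) $ 0) * norm (X (\<sigma> n) $ 4)) (norm (X (\<sigma> n) $ 1) * norm (X (\<sigma> n) $ 3)))
      \<longlonglongrightarrow> max (norm (Y $ 0) * norm (Y $ 4)) (norm (Y $ 1) * norm (Y $ 3))"
    by (intro tendsto_intros norm_lim)
  ultimately have max_Y: "max (norm (Y $ 0) * norm (Y $ 4)) (norm (Y $ 1) * norm (Y $ 3)) = 1"
    by (simp add: LIMSEQ_const_iff)
  have pair: "\<exists>x. (Y *v x) $ i * (Y *v x) $ j \<noteq> 0" if Yi: "Y $ i \<noteq> 0" and Yj: "Y $ j \<noteq> 0" for i j
  proof -
    obtain x where x: "(Y *v x) $ i \<noteq> 0" by (rule mat_vec_row_nonzero[OF Yi])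
    obtain y where y: "(Y *v y) $ j \<noteq> 0" by (rule mat_vec_row_nonzero[OF Yj])
    obtain z where "(Y *v z) $ i \<noteq> 0" "(Y *v z) $ j \<noteq> 0"
      by (rule poly_on_lines_mult_nonzero[OF poly_on_lines_mat_vec poly_on_lines_mat_vec x y])
    then show ?thesis by (intro exI[of _ z]) simp
  qed
  have "(Y $ 0 \<noteq> 0 \<and> Y $ 4 \<noteq> 0) \<or> (Y $ 1 \<noteq> 0 \<and> Y $ 3 \<noteq> 0)"
    using max_Y by (auto simp: max_def split: if_splits)
  then obtain x0 where "(Y *v x0) $ 0 * (Y *v x0) $ 4 \<noteq> 0 \<or> (Y *v x0) $ 1 * (Y *v x0) $ 3 \<noteq> 0"
    using pair by blast
  \<comment> \<open>Since r and s differ, u and v are linear combinations of the two quadrics, so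
    these cannot both vanish in the limit. Each surviving quadric then forces the other to
    survive.\<close>
  moreover have "(s - r) * ((Y *v x0) $ 0 * (Y *v x0) $ 4)
      = s * split_quadric r (Y *v x0) - r * split_quadric s (Y *v x0)"
    "(s - r) * ((Y *v x0) $ 1 * (Y *v x0) $ 3)
      = split_quadric r (Y *v x0) - split_quadric s (Y *v x0)"
    by (simp_all add: split_quadric_def algebra_simps)
  ultimately have "split_quadric r (Y *v x0) \<noteq> 0 \<or> split_quadric s (Y *v x0) \<noteq> 0"
    using \<open>r \<noteq> s\<close> by auto
  moreover have "\<exists>x. split_quadric r (Y *v x) \<noteq> 0" if "split_quadric s (Y *v x0) \<noteq> 0"
    by (rule split_quadric_limit_nonzero[OF Y det_X \<open>k \<noteq> 0\<close> \<open>r \<noteq> 0\<close> lim_t[unfolded p_def] Y2 that])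
  moreover have "\<exists>x. split_quadric s (Y *v x) \<noteq> 0" if "split_quadric r (Y *v x0) \<noteq> 0"
  proof -
    have "(\<lambda>n. of_real (t (\<sigma> n)) * (k * ((X (\<sigma> n) *v x) $ 2 * split_quadric s (X (\<sigma> n) *v x)
      * split_quadric r (X (\<sigma> n) *v x)))) \<longlonglongrightarrow> g x" for x
      using lim_t[of x] by (simp add: p_def mult_ac)
    then show ?thesis
      by (rule split_quadric_limit_nonzero[OF Y det_X \<open>k \<noteq> 0\<close> \<open>s \<noteq> 0\<close> _ Y2 that])
  qed
  ultimately obtain xr xs where xr: "split_quadric r (Y *v xr) \<noteq> 0" and xs: "split_quadric s (Y *v xs) \<noteq> 0"
    by blast
  obtain x2 where x2: "(Y *v x2) $ 2 \<noteq> 0" by (rule mat_vec_row_nonzero[OF Y2])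
  obtain y where "(Y *v y) $ 2 \<noteq> 0" "split_quadric r (Y *v y) \<noteq> 0"
    by (rule poly_on_lines_mult_nonzero[OF poly_on_lines_mat_vec poly_on_lines_split_quadric x2 xr])
  then have "(Y *v y) $ 2 * split_quadric r (Y *v y) \<noteq> 0" by simp
  from poly_on_lines_mult_nonzero[OF poly_on_lines_mult[OF poly_on_lines_mat_vec
        poly_on_lines_split_quadric] poly_on_lines_split_quadric this xs]
  obtain z where "(Y *v z) $ 2 * split_quadric r (Y *v z) \<noteq> 0" "split_quadric s (Y *v z) \<noteq> 0"
    by blast
  then have z: "p (Y *v z) \<noteq> 0" using \<open>k \<noteq> 0\<close> by (simp add: p_def)
  have "\<exists>B. det B = 1 \<and> (\<forall>x. g x = p (B *v x))"
  proof (rule rescale_limit[OF Y det_X lim_t _ _ z])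
    show "continuous_on UNIV p"
      unfolding p_def split_quadric_def by (intro continuous_intros)
  qed (simp add: p_def split_quadric_def)
  then show ?thesis by (simp only: p_def)
qed

text \<open>Chosen so that x0 x4 becomes y0^2 + y4^2 and - r x1 x3 becomes y1^2 + y3^2.\<close>

definition diagonalising_coords :: "complex \<Rightarrow> complex ^ 5 ^ 5" where
  "diagonalising_coords r = (\<chi> i j.
     if i = 0 then (if j = 0 then 1 else if j = 4 then \<i> else 0)
     else if i = 4 then (if j = 0 then 1 else if j = 4 then - \<i> else 0)
     else if i = 1 then (if j = 1 then 1 else if j = 3 then \<i> else 0)
     else if i = 3 then (if j = 1 then - 1 / r else if j = 3 then \<i> / r else 0)
     else (if j = 2 then 1 else 0))"

lemma diagonalising_coords_nth:
  "(diagonalising_coords r *v y) $ 0 = y$0 + \<i> * y$4"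
  "(diagonalising_coords r *v y) $ 1 = y$1 + \<i> * y$3"
  "(diagonalising_coords r *v y) $ 2 = y$2"
  "(diagonalising_coords r *v y) $ 3 = - (y$1 - \<i> * y$3) / r"
  "(diagonalising_coords r *v y) $ 4 = y$0 - \<i> * y$4"
  by (simp_all add: diagonalising_coords_def matrix_vector_mult_def sum_5 diff_divide_distrib)

lemma invertible_diagonalising_coords:
  assumes "r \<noteq> 0"
  shows "invertible (diagonalising_coords r)"
proof -
  have "y = 0" if "diagonalising_coords r *v y = 0" for y
  proof -
    have "\<forall>i. (diagonalising_coords r *v y) $ i = 0" using that by simp
    then have *: "y$0 + \<i> * y$4 = 0" "y$1 + \<i> * y$3 = 0" "y$2 = 0" "y$1 - \<i> * y$3 = 0" "y$0 - \<i> * y$4 = 0"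
      using assms unfolding forall_5 diagonalising_coords_nth by auto
    have "2 * y$0 = (y$0 + \<i> * y$4) + (y$0 - \<i> * y$4)" "2 * y$1 = (y$1 + \<i> * y$3) + (y$1 - \<i> * y$3)"
      by simp_all
    then have "y$0 = 0" "y$1 = 0" unfolding * by simp_all
    with * show ?thesis by (simp add: vec_eq_iff forall_5)
  qed
  then show ?thesis
    using matrix_left_invertible_ker[of "diagonalising_coords r"]
    by (simp add: invertible_left_inverse)
qed

lemma split_quadric_diagonalising:
  assumes "r \<noteq> 0"
  shows "split_quadric r (diagonalising_coords r *v y) = (y$0)^2 + (y$1)^2 + (y$3)^2 + (y$4)^2"
  using assms
  by (simp add: split_quadric_def diagonalising_coords_nth)
     (simp add: algebra_simps power2_eq_square)

section \<open>Case distinction on the two quadrics and conclusion\<close>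

lemma closed_orbit_split:
  assumes "a \<noteq> 0" "r \<noteq> 0" "s \<noteq> 0"
    and F: "equation_up_to_coords F (\<lambda>x. a * (x$2 * split_quadric r x * split_quadric s x))"
  shows "closed (SL_orbit F)"
proof (cases "r = s")
  case False
  show ?thesis
    by (rule closed_orbitI[OF F], rule closed_case_split[OF \<open>a \<noteq> 0\<close> \<open>r \<noteq> 0\<close> \<open>s \<noteq> 0\<close> False])
next
  \<comment> \<open>A repeated factor no longer determines u and v separately, but the form is now a
    linear form times the square of a sum of four squares.\<close>
  case True
  have "equation_up_to_coords F
      (\<lambda>x. a * (x$2 * ((x$0)^2 + (x$1)^2 + (x$3)^2 + (x$4)^2)^2))"
    by (rule equation_up_to_coords_comp[OF F invertible_diagonalising_coords[OF \<open>r \<noteq> 0\<close>]])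
       (simp only: True[symmetric] split_quadric_diagonalising[OF \<open>r \<noteq> 0\<close>] diagonalising_coords_nth
         power2_eq_square[of "_ + _ + _ + _"] mult.assoc)
  then show ?thesis
    by (rule closed_orbitI, intro closed_case_square[OF \<open>a \<noteq> 0\<close>])
qed

theorem proposition28:
  fixes F :: quintic_form
  assumes "\<exists>a b c. (a \<noteq> 0 \<or> b \<noteq> 0 \<or> c \<noteq> 0) \<and> equation_up_to_coords F
    (\<lambda>x. a * ((x$0)^2 * x$2 * (x$4)^2) + b * (x$0 * x$1 * x$2 * x$3 * x$4)
          + c * ((x$1)^2 * x$2 * (x$3)^2))"
  shows "(US1_I F \<or> US2_I F \<longrightarrow> unstable F) \<and>
    (SS1_I F \<longrightarrow> \<not> closed (SL_orbit F) \<and> degenerates_to_MO2_V F) \<and>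
    (SS2_I F \<longrightarrow> \<not> closed (SL_orbit F) \<and> degenerates_to_MO2_V F) \<and>
    (\<not> US1_I F \<and> \<not> US2_I F \<and> \<not> SS1_I F \<and> \<not> SS2_I F \<longrightarrow> closed (SL_orbit F))"
proof -
  have "closed (SL_orbit F)" if no: "\<not> US1_I F" "\<not> US2_I F" "\<not> SS1_I F" "\<not> SS2_I F"
  proof -
    obtain a b c where abc: "a \<noteq> 0 \<or> b \<noteq> 0 \<or> c \<noteq> 0" and F: "equation_up_to_coords F
      (\<lambda>x. a * ((x$0)^2 * x$2 * (x$4)^2) + b * (x$0 * x$1 * x$2 * x$3 * x$4)
          + c * ((x$1)^2 * x$2 * (x$3)^2))"
      using assms by blast
    \<comment> \<open>Outside the four families the coefficients a and c vanish together: either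
      only the product of the coordinates remains, or both outer terms are present.\<close>
    have 1: "a = 0" if "c = 0"
    proof (rule ccontr)
      assume "a \<noteq> 0"
      show False
      proof (cases "b = 0")
        case True
        then have "US1_I F" using F \<open>a \<noteq> 0\<close> \<open>c = 0\<close> unfolding US1_I_def by auto
        with no show False by simp
      next
        case False
        then have "SS1_I F" using F \<open>a \<noteq> 0\<close> \<open>c = 0\<close> unfolding SS1_I_def by auto
        with no show False by simp
      qed
    qed
    have 2: "c = 0" if "a = 0"
    proof (rule ccontr)
      assume "c \<noteq> 0"
      show False
      proof (cases "b = 0")
        case True
        then have "US2_I F" using F \<open>c \<noteq> 0\<close> \<open>a = 0\<close> unfolding US2_I_def by auto
        with no show False by simp
      next
        case False
        then have "SS2_I F" using F \<open>c \<noteq> 0\<close> \<open>a = 0\<close> unfolding SS2_I_def by auto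
        with no show False by simp
      qed
    qed
    show ?thesis
    proof (cases "a = 0")
      case True
      with 2 abc have "c = 0" "b \<noteq> 0" by auto
      have "equation_up_to_coords F (\<lambda>x. b * (\<Prod>i\<in>UNIV. x $ i))"
        using F \<open>a = 0\<close> \<open>c = 0\<close> by (simp add: prod_5)
      then show ?thesis
        by (rule closed_orbitI, intro closed_case_monomial[OF \<open>b \<noteq> 0\<close>])
    next
      case False
      with 1 have "c \<noteq> 0" by auto
      \<comment> \<open>The numbers r and s are the roots of a T^2 + b T + c, which gives a u^2 + b
        u v + c v^2 = a (u - r v) (u - s v). They are nonzero because c is.\<close>
      define d where "d = csqrt (b^2 - 4 * a * c)"
      define r where "r = (- b + d) / (2 * a)"
      define s where "s = (- b - d) / (2 * a)"
      have rs: "a * (r + s) = - b" "a * (r * s) = c"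
      proof -
        have "(2 * a * r) * (2 * a * s) = (- b + d) * (- b - d)"
          using \<open>a \<noteq> 0\<close> by (simp add: r_def s_def)
        also have "\<dots> = b^2 - d^2" by (simp add: algebra_simps power2_eq_square)
        also have "\<dots> = 4 * a * c" by (simp add: d_def)
        finally have "(4 * a) * (a * (r * s)) = (4 * a) * c" by (simp add: mult_ac)
        then show "a * (r * s) = c" using \<open>a \<noteq> 0\<close> by simp
        show "a * (r + s) = - b" using \<open>a \<noteq> 0\<close> by (simp add: r_def s_def field_simps)
      qed
      then have nz: "r \<noteq> 0" "s \<noteq> 0" using \<open>c \<noteq> 0\<close> by auto
      have "a * ((x$0)^2 * x$2 * (x$4)^2) + b * (x$0 * x$1 * x$2 * x$3 * x$4)
          + c * ((x$1)^2 * x$2 * (x$3)^2) = a * (x$2 * split_quadric r x * split_quadric s x)"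
        for x :: "complex^5"
      proof -
        have "a * (x$2 * split_quadric r x * split_quadric s x) = a * ((x$0)^2 * x$2 * (x$4)^2)
          - (a * (r + s)) * (x$0 * x$1 * x$2 * x$3 * x$4) + (a * (r * s)) * ((x$1)^2 * x$2 * (x$3)^2)"
          by (simp add: split_quadric_def algebra_simps power2_eq_square)
        then show ?thesis unfolding rs by simp
      qed
      then have "equation_up_to_coords F (\<lambda>x. a * (x$2 * split_quadric r x * split_quadric s x))"
        using F by simp
      then show ?thesis by (rule closed_orbit_split[OF \<open>a \<noteq> 0\<close> nz])
    qed
  qed
  then show ?thesis
    using US1_I_imp_unstable US2_I_imp_US1_I SS1_I_imp SS2_I_imp_SS1_I by blast
qed

end
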